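(* Let $R$ be a $\mathbb{Z}$-graded graded-commutative ring and let $\mathsf{T}$ be a graded $R$-linear triangulated category that is strongly generated and idempotent complete. Then every locally finitely presented cohomological graded $R$-linear functor $\mathsf{f} \colon \mathsf{T}^{op} \to \operatorname{grMod}(R)$ is graded representable.
   Context: Graded modules. A $\mathbb{Z}$-graded ring $R=\coprod_{d} R_d$ is graded-commutative if $rs=(-1)^{de}sr$ for $r\in R_d$, $s\in R_e$. $\operatorname{grMod}(R)$ is the category of graded $R$-modules with degree-preserving $R$-linear maps. The shift is $(M[n])_d=M_{n+d}$, where a homogeneous $r\in R$ acts on $M[n]$ by $(-1)^{n|r|}$ times its action on $M$ (Koszul sign convention). Graded linear categories. Let $\mathsf{T}$ be a triangulated category with suspension $\Sigma$. Write $\operatorname{Ext}^*_{\mathsf{T}}(X,Y)=\coprod_{d\in\mathbb{Z}}\operatorname{Hom}_{\mathsf{T}}(X,\Sigma^d Y)$. The graded center is $\operatorname{Z}(\mathsf{T})=\coprod_{d}\{\eta\colon \operatorname{id}_{\mathsf{T}}\to\Sigma^d \mid \eta\Sigma=(-1)^d\Sigma\eta\}$. $\mathsf{T}$ is graded $R$-linear if it is equipped with a homomorphism of graded rings $\varphi\colon R\to \operatorname{Z}(\mathsf{T})$; then $\operatorname{Ext}^*_{\mathsf{T}}(X,Y)$ is a graded $R$-module via $r\cdot h=\varphi(r)_{\Sigma^eY}\circ h=(\Sigma^{|r|}h)\circ\varphi(r)_X$ for $h\in\operatorname{Hom}_{\mathsf{T}}(X,\Sigma^eY)$ and homogeneous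 $r$. Graded linear functors. A functor $\mathsf{f}\colon\mathsf{T}^{op}\to\operatorname{grMod}(R)$ is graded $R$-linear if (i) $\mathsf{f}(\Sigma^nX)=\mathsf{f}(X)[-n]$ naturally in $X$, for all $n$; and (ii) the induced map from $\operatorname{Ext}^*_{\mathsf{T}}(X,Y)$ to the graded module $\coprod_d\operatorname{Hom}_{\operatorname{grMod}(R)}(\mathsf{f}(Y),\mathsf{f}(X)[d])$, sending $h\colon X\to\Sigma^dY$ to $\mathsf{f}(h)\colon \mathsf{f}(Y)[-d]\to \mathsf{f}(X)$ viewed as a degree $d$ map $\mathsf{f}(Y)\to\mathsf{f}(X)$, is a map of graded $R$-modules, where $(r\alpha)(m)=r\,\alpha(m)$. It is cohomological if it sends exact triangles to long exact sequences of graded $R$-modules. Natural transformations between graded $R$-linear functors are required to respect this structure (components are degree-preserving and $R$-linear, and compatible with the identifications in (i)). For $X\in\mathsf{T}$ let $\mathsf{g}_X=\operatorname{Ext}^*_{\mathsf{T}}(-,X)\colon\mathsf{T}^{op}\to\operatorname{grMod}(R)$, with the natural identification $\operatorname{Ext}^*_{\mathsf{T}}(\Sigma^nY,X)\cong\operatorname{Ext}^*_{\mathsf{T}}(Y,X)[-n]$ induced by $\Sigma^{-n}$. A functor is graded representable if it is naturally isomorphic to $\mathsf{g}_X$ for some $X\in\mathsf{T}$. Finiteness of functors. A graded $R$-linear functor $\mathsf{f}\colon\mathsf{T}^{op}\to\operatorname{grMod}(R)$ is locally finitely generated if for every $X\in\mathsf{T}$ there are $Y\in\mathsf{T}$ and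 a natural transformation $\zeta\colon\mathsf{g}_Y\to\mathsf{f}$ such that $\zeta(X)$ is surjective. It is locally finitely presented if it is locally finitely generated and, for every $Y \in \mathsf{T}$, the (objectwise) kernel of any natural transformation $\mathsf{g}_Y\to\mathsf{f}$ is locally finitely generated. $\mathsf{T}$ is idempotent complete if every idempotent endomorphism in $\mathsf{T}$ splits. Strong generation. For $G\in\mathsf{T}$ let $\operatorname{thick}^1(G)$ be the smallest full subcategory containing $G$ and closed under finite coproducts, retracts and (positive and negative) suspensions; for $n\ge2$ let $\operatorname{thick}^n(G)$ be the full subcategory of all $X$ for which there are $X'\in\mathsf{T}$ and an exact triangle $Y\to X\oplus X'\to Z\to\Sigma Y$ with $Y\in\operatorname{thick}^{n-1}(G)$ and $Z\in\operatorname{thick}^1(G)$. $\mathsf{T}$ is strongly generated if $\mathsf{T}=\operatorname{thick}^n(G)$ for some $G$ and some integer $n \geq 1$. *)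

theory Defs
  imports "HOL-Algebra.AbelCoset"
begin

text \<open>
  Every abelian group occurring here as a hom-set of a category or as a homogeneous component of
  a graded module is a \<^const>\<open>comm_group\<close> in the sense of HOL-Algebra, hence written
  multiplicatively: \<open>\<otimes>\<close> is the sum, \<open>\<one>\<close> is zero and \<open>inv\<close> is the negative.
\<close>

definition signed :: "('a, 'z) monoid_scheme \<Rightarrow> int \<Rightarrow> 'a \<Rightarrow> 'a" where
  "signed G n x = (if even n then x else inv\<^bsub>G\<^esub> x)"  \<comment> \<open>\<open>(-1)\<^sup>n x\<close>\<close>


section \<open>Graded rings and graded modules\<close>

locale graded_ring = ring R
  for R :: "('r, 'z) ring_scheme" (structure) +
  fixes A :: "int \<Rightarrow> 'r set"
  assumes component_subgroup: "additive_subgroup (A d) R"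
    and one_degree: "\<one> \<in> A 0"
    and mult_degree: "\<lbrakk>r \<in> A d; s \<in> A e\<rbrakk> \<Longrightarrow> r \<otimes> s \<in> A (d + e)"
    and direct_sum: "x \<in> carrier R \<Longrightarrow>
      \<exists>!c. (\<forall>d. c d \<in> A d) \<and> finite {d. c d \<noteq> \<zero>} \<and> x = finsum R c {d. c d \<noteq> \<zero>}"

locale graded_commutative_ring = graded_ring +
  assumes graded_commute: "\<lbrakk>r \<in> A d; s \<in> A e\<rbrakk> \<Longrightarrow>
    r \<otimes> s = (if even (d * e) then s \<otimes> r else \<ominus> (s \<otimes> r))"

text \<open>
  A graded module is given by its homogeneous components and the action of the homogeneous
  elements of the ring on them. The components need not be disjoint subsets of the type, so the
  operations carry degrees: \<open>act M a e r x\<close> is \<open>r x\<close> for \<open>r\<close> of degree \<open>a\<close>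
  and \<open>x\<close> of degree \<open>e\<close>. (The \<open>module\<close> locale of HOL-Algebra is not applicable, as it
  requires a commutative ring.)
\<close>

record ('r, 'n) gmod =
  deg :: "int \<Rightarrow> 'n monoid"
  act :: "int \<Rightarrow> int \<Rightarrow> 'r \<Rightarrow> 'n \<Rightarrow> 'n"

locale graded_module = graded_ring R A
  for R :: "('r, 'z) ring_scheme" (structure) and A :: "int \<Rightarrow> 'r set" +
  fixes M :: "('r, 'n) gmod"
  assumes deg_group: "comm_group (deg M d)"
    and act_closed: "\<lbrakk>r \<in> A a; x \<in> carrier (deg M e)\<rbrakk> \<Longrightarrow> act M a e r x \<in> carrier (deg M (a + e))"
    and act_add_left: "\<lbrakk>r \<in> A a; s \<in> A a; x \<in> carrier (deg M e)\<rbrakk> \<Longrightarrow>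
      act M a e (r \<oplus> s) x = act M a e r x \<otimes>\<^bsub>deg M (a + e)\<^esub> act M a e s x"
    and act_add_right: "\<lbrakk>r \<in> A a; x \<in> carrier (deg M e); y \<in> carrier (deg M e)\<rbrakk> \<Longrightarrow>
      act M a e r (x \<otimes>\<^bsub>deg M e\<^esub> y) = act M a e r x \<otimes>\<^bsub>deg M (a + e)\<^esub> act M a e r y"
    and act_mult: "\<lbrakk>r \<in> A a; s \<in> A b; x \<in> carrier (deg M e)\<rbrakk> \<Longrightarrow>
      act M (a + b) e (r \<otimes> s) x = act M a (b + e) r (act M b e s x)"
    and act_one: "x \<in> carrier (deg M e) \<Longrightarrow> act M 0 e \<one> x = x"

definition gmod_hom ::
  "(int \<Rightarrow> 'r set) \<Rightarrow> ('r, 'n) gmod \<Rightarrow> ('r, 'k) gmod \<Rightarrow> (int \<Rightarrow> 'n \<Rightarrow> 'k) \<Rightarrow> bool" where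
  "gmod_hom A M N \<alpha> \<longleftrightarrow>
     (\<forall>d. \<alpha> d \<in> hom (deg M d) (deg N d)) \<and>
     (\<forall>a e. \<forall>r\<in>A a. \<forall>x\<in>carrier (deg M e). \<alpha> (a + e) (act M a e r x) = act N a e r (\<alpha> e x))"

definition gmod_iso ::
  "(int \<Rightarrow> 'r set) \<Rightarrow> ('r, 'n) gmod \<Rightarrow> ('r, 'k) gmod \<Rightarrow> (int \<Rightarrow> 'n \<Rightarrow> 'k) \<Rightarrow> bool" where
  "gmod_iso A M N \<alpha> \<longleftrightarrow>
     gmod_hom A M N \<alpha> \<and> (\<forall>d. bij_betw (\<alpha> d) (carrier (deg M d)) (carrier (deg N d)))"

definition gmod_shift :: "('r, 'n) gmod \<Rightarrow> int \<Rightarrow> ('r, 'n) gmod" where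
  "gmod_shift M n =
     \<lparr>deg = (\<lambda>d. deg M (n + d)),
      act = (\<lambda>a e r x. signed (deg M (n + (a + e))) (n * a) (act M a (n + e) r x))\<rparr>"

text \<open>Exactness of \<open>L \<rightarrow> M \<rightarrow> N\<close> at \<open>M\<close>.\<close>

definition gmod_exact ::
  "('r, 'l) gmod \<Rightarrow> (int \<Rightarrow> 'l \<Rightarrow> 'n) \<Rightarrow> ('r, 'n) gmod \<Rightarrow> (int \<Rightarrow> 'n \<Rightarrow> 'k) \<Rightarrow> ('r, 'k) gmod \<Rightarrow> bool"
  where
  "gmod_exact L \<alpha> M \<beta> N \<longleftrightarrow>
     (\<forall>d. \<alpha> d ` carrier (deg L d) = kernel (deg M d) (deg N d) (\<beta> d))"


section \<open>Triangulated categories\<close>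

record ('o, 'm) precat =
  Ob :: "'o set"
  Hom :: "'o \<Rightarrow> 'o \<Rightarrow> 'm monoid"
  Comp :: "'m \<Rightarrow> 'm \<Rightarrow> 'm"  (infixr \<open>\<cdot>\<index>\<close> 75)
  Id :: "'o \<Rightarrow> 'm"

abbreviation Arr :: "('o, 'm, 'z) precat_scheme \<Rightarrow> 'o \<Rightarrow> 'o \<Rightarrow> 'm set" where
  "Arr T X Y \<equiv> carrier (Hom T X Y)"

locale preadditive_category =
  fixes T :: "('o, 'm, 'z) precat_scheme" (structure)
  assumes hom_group: "\<lbrakk>X \<in> Ob T; Y \<in> Ob T\<rbrakk> \<Longrightarrow> comm_group (Hom T X Y)"
    and hom_disjoint: "\<lbrakk>X \<in> Ob T; Y \<in> Ob T; X' \<in> Ob T; Y' \<in> Ob T;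
      h \<in> Arr T X Y; h \<in> Arr T X' Y'\<rbrakk> \<Longrightarrow> X = X' \<and> Y = Y'"
    and id_closed: "X \<in> Ob T \<Longrightarrow> Id T X \<in> Arr T X X"
    and comp_closed: "\<lbrakk>X \<in> Ob T; Y \<in> Ob T; Z \<in> Ob T; g \<in> Arr T Y Z; h \<in> Arr T X Y\<rbrakk> \<Longrightarrow>
      g \<cdot> h \<in> Arr T X Z"
    and id_left: "\<lbrakk>X \<in> Ob T; Y \<in> Ob T; h \<in> Arr T X Y\<rbrakk> \<Longrightarrow> Id T Y \<cdot> h = h"
    and id_right: "\<lbrakk>X \<in> Ob T; Y \<in> Ob T; h \<in> Arr T X Y\<rbrakk> \<Longrightarrow> h \<cdot> Id T X = h"
    and comp_assoc: "\<lbrakk>W \<in> Ob T; X \<in> Ob T; Y \<in> Ob T; Z \<in> Ob T;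
      k \<in> Arr T Y Z; g \<in> Arr T X Y; h \<in> Arr T W X\<rbrakk> \<Longrightarrow> (k \<cdot> g) \<cdot> h = k \<cdot> (g \<cdot> h)"
    and comp_add_left: "\<lbrakk>X \<in> Ob T; Y \<in> Ob T; Z \<in> Ob T;
      g \<in> Arr T Y Z; g' \<in> Arr T Y Z; h \<in> Arr T X Y\<rbrakk> \<Longrightarrow>
      (g \<otimes>\<^bsub>Hom T Y Z\<^esub> g') \<cdot> h = (g \<cdot> h) \<otimes>\<^bsub>Hom T X Z\<^esub> (g' \<cdot> h)"
    and comp_add_right: "\<lbrakk>X \<in> Ob T; Y \<in> Ob T; Z \<in> Ob T;
      g \<in> Arr T Y Z; h \<in> Arr T X Y; h' \<in> Arr T X Y\<rbrakk> \<Longrightarrow>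
      g \<cdot> (h \<otimes>\<^bsub>Hom T X Y\<^esub> h') = (g \<cdot> h) \<otimes>\<^bsub>Hom T X Z\<^esub> (g \<cdot> h')"

definition is_isomorphism ::
  "('o, 'm, 'z) precat_scheme \<Rightarrow> 'o \<Rightarrow> 'o \<Rightarrow> 'm \<Rightarrow> bool" where
  "is_isomorphism T X Y h \<longleftrightarrow>
     h \<in> Arr T X Y \<and> (\<exists>k\<in>Arr T Y X. k \<cdot>\<^bsub>T\<^esub> h = Id T X \<and> h \<cdot>\<^bsub>T\<^esub> k = Id T Y)"

definition zero_object :: "('o, 'm, 'z) precat_scheme \<Rightarrow> 'o \<Rightarrow> bool" where
  "zero_object T Z \<longleftrightarrow>
     Z \<in> Ob T \<and> (\<forall>X\<in>Ob T. (\<exists>!h. h \<in> Arr T X Z) \<and> (\<exists>!h. h \<in> Arr T Z X))"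

definition is_coproduct ::
  "('o, 'm, 'z) precat_scheme \<Rightarrow> 'o \<Rightarrow> 'o \<Rightarrow> 'o \<Rightarrow> 'm \<Rightarrow> 'm \<Rightarrow> bool" where
  "is_coproduct T X Y C i j \<longleftrightarrow>
     C \<in> Ob T \<and> i \<in> Arr T X C \<and> j \<in> Arr T Y C \<and>
     (\<forall>W\<in>Ob T. \<forall>f\<in>Arr T X W. \<forall>g\<in>Arr T Y W.
        \<exists>!h. h \<in> Arr T C W \<and> h \<cdot>\<^bsub>T\<^esub> i = f \<and> h \<cdot>\<^bsub>T\<^esub> j = g)"

definition is_retract :: "('o, 'm, 'z) precat_scheme \<Rightarrow> 'o \<Rightarrow> 'o \<Rightarrow> bool" where
  "is_retract T X Y \<longleftrightarrow>
     X \<in> Ob T \<and> Y \<in> Ob T \<and> (\<exists>i\<in>Arr T X Y. \<exists>p\<in>Arr T Y X. p \<cdot>\<^bsub>T\<^esub> i = Id T X)"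

text \<open>In a preadditive category finite coproducts are automatically biproducts.\<close>

locale additive_category = preadditive_category +
  assumes has_zero: "\<exists>Z. zero_object T Z"
    and has_coproducts: "\<lbrakk>X \<in> Ob T; Y \<in> Ob T\<rbrakk> \<Longrightarrow> \<exists>C i j. is_coproduct T X Y C i j"

text \<open>
  The suspension is an automorphism of the category. It is recorded together with all of its
  integer powers, which is the same as a strict action of the integers: \<open>\<Sigma>\<^sup>n\<close> is
  \<open>susp_ob T n\<close> on objects and \<open>susp T n\<close> on morphisms.
  \<open>exact_tri T X Y Z u v w\<close> says that \<open>X \<rightarrow> Y \<rightarrow> Z \<rightarrow> \<Sigma>X\<close> with maps \<open>u\<close>, \<open>v\<close>, \<open>w\<close>
  is an exact triangle.
\<close>

record ('o, 'm) tricat = "('o, 'm) precat" +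
  susp_ob :: "int \<Rightarrow> 'o \<Rightarrow> 'o"
  susp :: "int \<Rightarrow> 'm \<Rightarrow> 'm"
  exact_tri :: "'o \<Rightarrow> 'o \<Rightarrow> 'o \<Rightarrow> 'm \<Rightarrow> 'm \<Rightarrow> 'm \<Rightarrow> bool"

locale triangulated_category = additive_category T
  for T :: "('o, 'm, 'z) tricat_scheme" (structure) +
  assumes susp_ob_closed: "X \<in> Ob T \<Longrightarrow> susp_ob T n X \<in> Ob T"
    and susp_hom: "\<lbrakk>X \<in> Ob T; Y \<in> Ob T\<rbrakk> \<Longrightarrow>
      susp T n \<in> hom (Hom T X Y) (Hom T (susp_ob T n X) (susp_ob T n Y))"
    and susp_id: "X \<in> Ob T \<Longrightarrow> susp T n (Id T X) = Id T (susp_ob T n X)"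
    and susp_comp: "\<lbrakk>X \<in> Ob T; Y \<in> Ob T; Z \<in> Ob T; g \<in> Arr T Y Z; h \<in> Arr T X Y\<rbrakk> \<Longrightarrow>
      susp T n (g \<cdot> h) = susp T n g \<cdot> susp T n h"
    and susp_ob_zero: "X \<in> Ob T \<Longrightarrow> susp_ob T 0 X = X"
    and susp_ob_add: "X \<in> Ob T \<Longrightarrow> susp_ob T (m + n) X = susp_ob T m (susp_ob T n X)"
    and susp_zero: "\<lbrakk>X \<in> Ob T; Y \<in> Ob T; h \<in> Arr T X Y\<rbrakk> \<Longrightarrow> susp T 0 h = h"
    and susp_add: "\<lbrakk>X \<in> Ob T; Y \<in> Ob T; h \<in> Arr T X Y\<rbrakk> \<Longrightarrow>
      susp T (m + n) h = susp T m (susp T n h)"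
    and tri_closed: "exact_tri T X Y Z u v w \<Longrightarrow>
      X \<in> Ob T \<and> Y \<in> Ob T \<and> Z \<in> Ob T \<and>
      u \<in> Arr T X Y \<and> v \<in> Arr T Y Z \<and> w \<in> Arr T Z (susp_ob T 1 X)"
    and TR1_iso: "\<lbrakk>exact_tri T X Y Z u v w; X' \<in> Ob T; Y' \<in> Ob T; Z' \<in> Ob T;
      u' \<in> Arr T X' Y'; v' \<in> Arr T Y' Z'; w' \<in> Arr T Z' (susp_ob T 1 X');
      is_isomorphism T X X' a; is_isomorphism T Y Y' b; is_isomorphism T Z Z' c;
      u' \<cdot> a = b \<cdot> u; v' \<cdot> b = c \<cdot> v; w' \<cdot> c = susp T 1 a \<cdot> w\<rbrakk> \<Longrightarrow>
      exact_tri T X' Y' Z' u' v' w'"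
    and TR1_id: "\<lbrakk>X \<in> Ob T; zero_object T Z\<rbrakk> \<Longrightarrow>
      exact_tri T X X Z (Id T X) \<one>\<^bsub>Hom T X Z\<^esub> \<one>\<^bsub>Hom T Z (susp_ob T 1 X)\<^esub>"
    and TR1_cone: "\<lbrakk>X \<in> Ob T; Y \<in> Ob T; u \<in> Arr T X Y\<rbrakk> \<Longrightarrow> \<exists>Z v w. exact_tri T X Y Z u v w"
    and TR2: "\<lbrakk>X \<in> Ob T; Y \<in> Ob T; Z \<in> Ob T;
      u \<in> Arr T X Y; v \<in> Arr T Y Z; w \<in> Arr T Z (susp_ob T 1 X)\<rbrakk> \<Longrightarrow>
      exact_tri T X Y Z u v w \<longleftrightarrow>
      exact_tri T Y Z (susp_ob T 1 X) v w
        (inv\<^bsub>Hom T (susp_ob T 1 X) (susp_ob T 1 Y)\<^esub> (susp T 1 u))"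
    and TR3: "\<lbrakk>exact_tri T X Y Z u v w; exact_tri T X' Y' Z' u' v' w';
      a \<in> Arr T X X'; b \<in> Arr T Y Y'; b \<cdot> u = u' \<cdot> a\<rbrakk> \<Longrightarrow>
      \<exists>c\<in>Arr T Z Z'. c \<cdot> v = v' \<cdot> b \<and> susp T 1 a \<cdot> w = w' \<cdot> c"
    and TR4: "\<lbrakk>exact_tri T X Y Z' u a b; exact_tri T Y Z X' v c d;
      exact_tri T X Z Y' (v \<cdot> u) e k\<rbrakk> \<Longrightarrow>
      \<exists>p\<in>Arr T Z' Y'. \<exists>q\<in>Arr T Y' X'.
        exact_tri T Z' Y' X' p q (susp T 1 a \<cdot> d) \<and>
        p \<cdot> a = e \<cdot> v \<and> k \<cdot> p = b \<and> q \<cdot> e = c \<and> d \<cdot> q = susp T 1 u \<cdot> k"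

definition idempotent_complete :: "('o, 'm, 'z) precat_scheme \<Rightarrow> bool" where
  "idempotent_complete T \<longleftrightarrow>
     (\<forall>X\<in>Ob T. \<forall>h\<in>Arr T X X. h \<cdot>\<^bsub>T\<^esub> h = h \<longrightarrow>
        (\<exists>Y\<in>Ob T. \<exists>p\<in>Arr T X Y. \<exists>i\<in>Arr T Y X. i \<cdot>\<^bsub>T\<^esub> p = h \<and> p \<cdot>\<^bsub>T\<^esub> i = Id T Y))"


subsection \<open>Strong generation\<close>

text \<open>
  Full subcategories are sets of objects. Finite coproducts are the empty one (a zero object)
  and the binary ones.
\<close>

inductive_set thick1 :: "('o, 'm, 'z) tricat_scheme \<Rightarrow> 'o \<Rightarrow> 'o set"
  for T :: "('o, 'm, 'z) tricat_scheme" and G :: 'o where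
  generator: "G \<in> thick1 T G"
| zero: "zero_object T Z \<Longrightarrow> Z \<in> thick1 T G"
| coproduct: "\<lbrakk>X \<in> thick1 T G; Y \<in> thick1 T G; is_coproduct T X Y C i j\<rbrakk> \<Longrightarrow> C \<in> thick1 T G"
| retract: "\<lbrakk>Y \<in> thick1 T G; is_retract T X Y\<rbrakk> \<Longrightarrow> X \<in> thick1 T G"
| suspension: "X \<in> thick1 T G \<Longrightarrow> susp_ob T n X \<in> thick1 T G"

fun thick :: "('o, 'm, 'z) tricat_scheme \<Rightarrow> nat \<Rightarrow> 'o \<Rightarrow> 'o set" where
  "thick T 0 G = {}"  \<comment> \<open>junk value; \<open>thick\<close> starts at 1\<close>
| "thick T (Suc 0) G = thick1 T G"
| "thick T (Suc (Suc n)) G =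
     {X \<in> Ob T. \<exists>X'\<in>Ob T. \<exists>C i j Y Z u v w.
        is_coproduct T X X' C i j \<and> exact_tri T Y C Z u v w \<and>
        Y \<in> thick T (Suc n) G \<and> Z \<in> thick1 T G}"

definition strongly_generated :: "('o, 'm, 'z) tricat_scheme \<Rightarrow> bool" where
  "strongly_generated T \<longleftrightarrow> (\<exists>G\<in>Ob T. \<exists>n\<ge>1. thick T n G = Ob T)"


section \<open>Graded linear categories\<close>

text \<open>
  Degree \<open>d\<close> part of the graded center. The product of \<open>\<eta>\<close> with \<open>\<theta>\<close> of degree \<open>e\<close> is
  the composite \<open>id \<rightarrow> \<Sigma>\<^sup>e \<rightarrow> \<Sigma>\<^sup>d\<Sigma>\<^sup>e\<close>, with components \<open>\<eta> (\<Sigma>\<^sup>e X) \<cdot> \<theta> X\<close>; this is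
  the product for which the action on Ext below is a left module structure.
\<close>

definition graded_center :: "('o, 'm, 'z) tricat_scheme \<Rightarrow> int \<Rightarrow> ('o \<Rightarrow> 'm) set" where
  "graded_center T d =
     {\<eta>. (\<forall>X\<in>Ob T. \<eta> X \<in> Arr T X (susp_ob T d X)) \<and>
         (\<forall>X\<in>Ob T. \<forall>Y\<in>Ob T. \<forall>h\<in>Arr T X Y. \<eta> Y \<cdot>\<^bsub>T\<^esub> h = susp T d h \<cdot>\<^bsub>T\<^esub> \<eta> X) \<and>
         (\<forall>X\<in>Ob T. \<eta> (susp_ob T 1 X) =
            signed (Hom T (susp_ob T 1 X) (susp_ob T (d + 1) X)) d (susp T 1 (\<eta> X)))}"

text \<open>
  The degree is an argument of \<open>\<phi>\<close> because the zero of \<open>R\<close> is homogeneous of every degree.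
\<close>

locale graded_linear_category = graded_commutative_ring R A + triangulated_category T
  for R :: "('r, 'y) ring_scheme" and A :: "int \<Rightarrow> 'r set"
    and T :: "('o, 'm, 'z) tricat_scheme" +
  fixes \<phi> :: "int \<Rightarrow> 'r \<Rightarrow> 'o \<Rightarrow> 'm"
  assumes central: "r \<in> A d \<Longrightarrow> \<phi> d r \<in> graded_center T d"
    and central_add: "\<lbrakk>r \<in> A d; s \<in> A d; X \<in> Ob T\<rbrakk> \<Longrightarrow>
      \<phi> d (r \<oplus>\<^bsub>R\<^esub> s) X = \<phi> d r X \<otimes>\<^bsub>Hom T X (susp_ob T d X)\<^esub> \<phi> d s X"
    and central_mult: "\<lbrakk>r \<in> A d; s \<in> A e; X \<in> Ob T\<rbrakk> \<Longrightarrow>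
      \<phi> (d + e) (r \<otimes>\<^bsub>R\<^esub> s) X = \<phi> d r (susp_ob T e X) \<cdot>\<^bsub>T\<^esub> \<phi> e s X"
    and central_one: "X \<in> Ob T \<Longrightarrow> \<phi> 0 \<one>\<^bsub>R\<^esub> X = Id T X"

definition Ext ::
  "('o, 'm, 'z) tricat_scheme \<Rightarrow> (int \<Rightarrow> 'r \<Rightarrow> 'o \<Rightarrow> 'm) \<Rightarrow> 'o \<Rightarrow> 'o \<Rightarrow> ('r, 'm) gmod" where
  "Ext T \<phi> X Y =
     \<lparr>deg = (\<lambda>d. Hom T X (susp_ob T d Y)),
      act = (\<lambda>a e r h. \<phi> a r (susp_ob T e Y) \<cdot>\<^bsub>T\<^esub> h)\<rparr>"


section \<open>Graded linear functors\<close>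

text \<open>
  The data of a contravariant functor to graded modules that comes with identifications
  \<open>fun_shift F n X : F(X)[-n] \<cong> F(\<Sigma>\<^sup>n X)\<close>; in degree \<open>d\<close> these are maps from \<open>F(X)\<close> in
  degree \<open>d - n\<close> to \<open>F(\<Sigma>\<^sup>n X)\<close> in degree \<open>d\<close>.
\<close>

record ('o, 'm, 'r, 'n) gfun =
  fun_ob :: "'o \<Rightarrow> ('r, 'n) gmod"
  fun_map :: "'m \<Rightarrow> int \<Rightarrow> 'n \<Rightarrow> 'n"
  fun_shift :: "int \<Rightarrow> 'o \<Rightarrow> int \<Rightarrow> 'n \<Rightarrow> 'n"

text \<open>
  For \<open>h : X \<rightarrow> \<Sigma>\<^sup>d Y\<close>, the map \<open>F(h)\<close> viewed as a map \<open>F(Y) \<rightarrow> F(X)\<close> of degree \<open>d\<close>,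
  evaluated at an element \<open>x\<close> of \<open>F(Y)\<close> of degree \<open>e\<close>.
\<close>

definition degree_map ::
  "('o, 'm, 'r, 'n) gfun \<Rightarrow> int \<Rightarrow> 'o \<Rightarrow> 'm \<Rightarrow> int \<Rightarrow> 'n \<Rightarrow> 'n" where
  "degree_map F d Y h e x = fun_map F h (d + e) (fun_shift F d Y (d + e) x)"

text \<open>
  The identifications of \<open>F(\<Sigma>\<^sup>n X)\<close> with \<open>F(X)[-n]\<close> are usually written as equalities, so for
  varying \<open>n\<close> they are compatible with \<open>\<Sigma>\<^sup>m\<^sup>+\<^sup>n = \<Sigma>\<^sup>m\<Sigma>\<^sup>n\<close> and \<open>[-m-n] = [-n][-m]\<close>; this is
  \<open>shift_add\<close>. The assumptions \<open>degree_map_add\<close> and \<open>degree_map_act\<close> say that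
  \<open>Ext(X,Y) \<rightarrow> \<Coprod>\<^sub>d Hom(F(Y), F(X)[d])\<close> is a map of graded modules, where ring elements
  act on the target by \<open>(r \<alpha>)(x) = r \<alpha>(x)\<close>.
\<close>

locale graded_linear_functor = graded_linear_category R A T \<phi>
  for R :: "('r, 'y) ring_scheme" and A :: "int \<Rightarrow> 'r set"
    and T :: "('o, 'm, 'z) tricat_scheme" and \<phi> :: "int \<Rightarrow> 'r \<Rightarrow> 'o \<Rightarrow> 'm" +
  fixes F :: "('o, 'm, 'r, 'n) gfun"
  assumes ob_module: "X \<in> Ob T \<Longrightarrow> graded_module R A (fun_ob F X)"
    and map_hom: "\<lbrakk>X \<in> Ob T; Y \<in> Ob T; h \<in> Arr T X Y\<rbrakk> \<Longrightarrow>
      gmod_hom A (fun_ob F Y) (fun_ob F X) (fun_map F h)"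
    and map_id: "\<lbrakk>X \<in> Ob T; x \<in> carrier (deg (fun_ob F X) d)\<rbrakk> \<Longrightarrow> fun_map F (Id T X) d x = x"
    and map_comp: "\<lbrakk>X \<in> Ob T; Y \<in> Ob T; Z \<in> Ob T; g \<in> Arr T Y Z; h \<in> Arr T X Y;
      x \<in> carrier (deg (fun_ob F Z) d)\<rbrakk> \<Longrightarrow>
      fun_map F (g \<cdot>\<^bsub>T\<^esub> h) d x = fun_map F h d (fun_map F g d x)"
    and shift_iso: "X \<in> Ob T \<Longrightarrow>
      gmod_iso A (gmod_shift (fun_ob F X) (-n)) (fun_ob F (susp_ob T n X)) (fun_shift F n X)"
    and shift_natural: "\<lbrakk>X \<in> Ob T; Y \<in> Ob T; h \<in> Arr T X Y;
      x \<in> carrier (deg (fun_ob F Y) (-n + d))\<rbrakk> \<Longrightarrow>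
      fun_map F (susp T n h) d (fun_shift F n Y d x) = fun_shift F n X d (fun_map F h (-n + d) x)"
    and shift_add: "\<lbrakk>X \<in> Ob T; x \<in> carrier (deg (fun_ob F X) (-(m + n) + d))\<rbrakk> \<Longrightarrow>
      fun_shift F (m + n) X d x = fun_shift F m (susp_ob T n X) d (fun_shift F n X (-m + d) x)"
    and degree_map_add: "\<lbrakk>X \<in> Ob T; Y \<in> Ob T;
      h \<in> Arr T X (susp_ob T d Y); h' \<in> Arr T X (susp_ob T d Y);
      x \<in> carrier (deg (fun_ob F Y) e)\<rbrakk> \<Longrightarrow>
      degree_map F d Y (h \<otimes>\<^bsub>deg (Ext T \<phi> X Y) d\<^esub> h') e x =
      degree_map F d Y h e x \<otimes>\<^bsub>deg (fun_ob F X) (d + e)\<^esub> degree_map F d Y h' e x"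
    and degree_map_act: "\<lbrakk>X \<in> Ob T; Y \<in> Ob T; h \<in> Arr T X (susp_ob T d Y); r \<in> A a;
      x \<in> carrier (deg (fun_ob F Y) e)\<rbrakk> \<Longrightarrow>
      degree_map F (a + d) Y (act (Ext T \<phi> X Y) a d r h) e x =
      act (fun_ob F X) a (d + e) r (degree_map F d Y h e x)"

text \<open>
  The long exact sequence of an exact triangle is
  \<open>\<dots> \<rightarrow> F(\<Sigma>\<^sup>n\<^sup>+\<^sup>1 Y) \<rightarrow> F(\<Sigma>\<^sup>n\<^sup>+\<^sup>1 X) \<rightarrow> F(\<Sigma>\<^sup>n Z) \<rightarrow> F(\<Sigma>\<^sup>n Y) \<rightarrow> F(\<Sigma>\<^sup>n X) \<rightarrow> \<dots>\<close>
\<close>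

definition cohomological :: "('o, 'm, 'z) tricat_scheme \<Rightarrow> ('o, 'm, 'r, 'n) gfun \<Rightarrow> bool" where
  "cohomological T F \<longleftrightarrow>
     (\<forall>X Y Z u v w. exact_tri T X Y Z u v w \<longrightarrow>
        (\<forall>n. let F\<^sub>n = (\<lambda>V. fun_ob F (susp_ob T n V));
                 F\<^sub>n\<^sub>1 = (\<lambda>V. fun_ob F (susp_ob T (n + 1) V)) in
           gmod_exact (F\<^sub>n\<^sub>1 Y) (fun_map F (susp T (n + 1) u)) (F\<^sub>n\<^sub>1 X) (fun_map F (susp T n w)) (F\<^sub>n Z) \<and>
           gmod_exact (F\<^sub>n\<^sub>1 X) (fun_map F (susp T n w)) (F\<^sub>n Z) (fun_map F (susp T n v)) (F\<^sub>n Y) \<and>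
           gmod_exact (F\<^sub>n Z) (fun_map F (susp T n v)) (F\<^sub>n Y) (fun_map F (susp T n u)) (F\<^sub>n X)))"

definition natural_transformation ::
  "(int \<Rightarrow> 'r set) \<Rightarrow> ('o, 'm, 'z) tricat_scheme \<Rightarrow> ('o, 'm, 'r, 'n) gfun \<Rightarrow> ('o, 'm, 'r, 'k) gfun \<Rightarrow>
   ('o \<Rightarrow> int \<Rightarrow> 'n \<Rightarrow> 'k) \<Rightarrow> bool" where
  "natural_transformation A T F F' \<zeta> \<longleftrightarrow>
     (\<forall>X\<in>Ob T. gmod_hom A (fun_ob F X) (fun_ob F' X) (\<zeta> X)) \<and>
     (\<forall>X\<in>Ob T. \<forall>Y\<in>Ob T. \<forall>h\<in>Arr T X Y. \<forall>d. \<forall>x\<in>carrier (deg (fun_ob F Y) d).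
        \<zeta> X d (fun_map F h d x) = fun_map F' h d (\<zeta> Y d x)) \<and>
     (\<forall>X\<in>Ob T. \<forall>n d. \<forall>x\<in>carrier (deg (fun_ob F X) (-n + d)).
        \<zeta> (susp_ob T n X) d (fun_shift F n X d x) = fun_shift F' n X d (\<zeta> X (-n + d) x))"

definition Ext_functor ::
  "('o, 'm, 'z) tricat_scheme \<Rightarrow> (int \<Rightarrow> 'r \<Rightarrow> 'o \<Rightarrow> 'm) \<Rightarrow> 'o \<Rightarrow> ('o, 'm, 'r, 'm) gfun" where
  "Ext_functor T \<phi> X =
     \<lparr>fun_ob = (\<lambda>Y. Ext T \<phi> Y X),
      fun_map = (\<lambda>h d k. k \<cdot>\<^bsub>T\<^esub> h),
      fun_shift = (\<lambda>n Y d k. susp T n k)\<rparr>"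

definition graded_representable ::
  "(int \<Rightarrow> 'r set) \<Rightarrow> ('o, 'm, 'z) tricat_scheme \<Rightarrow> (int \<Rightarrow> 'r \<Rightarrow> 'o \<Rightarrow> 'm) \<Rightarrow>
   ('o, 'm, 'r, 'n) gfun \<Rightarrow> bool" where
  "graded_representable A T \<phi> F \<longleftrightarrow>
     (\<exists>X\<in>Ob T. \<exists>\<zeta>. natural_transformation A T (Ext_functor T \<phi> X) F \<zeta> \<and>
        (\<forall>Y\<in>Ob T. gmod_iso A (fun_ob (Ext_functor T \<phi> X) Y) (fun_ob F Y) (\<zeta> Y)))"


section \<open>Finiteness of functors\<close>

definition kernel_functor ::
  "('o, 'm, 'r, 'n) gfun \<Rightarrow> ('o, 'm, 'r, 'k) gfun \<Rightarrow> ('o \<Rightarrow> int \<Rightarrow> 'n \<Rightarrow> 'k) \<Rightarrow>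
   ('o, 'm, 'r, 'n) gfun" where
  "kernel_functor F F' \<zeta> =
     F\<lparr>fun_ob := (\<lambda>X. (fun_ob F X)
         \<lparr>deg := (\<lambda>d. (deg (fun_ob F X) d)
            \<lparr>carrier := kernel (deg (fun_ob F X) d) (deg (fun_ob F' X) d) (\<zeta> X d)\<rparr>)\<rparr>)\<rparr>"

definition locally_finitely_generated ::
  "(int \<Rightarrow> 'r set) \<Rightarrow> ('o, 'm, 'z) tricat_scheme \<Rightarrow> (int \<Rightarrow> 'r \<Rightarrow> 'o \<Rightarrow> 'm) \<Rightarrow>
   ('o, 'm, 'r, 'n) gfun \<Rightarrow> bool" where
  "locally_finitely_generated A T \<phi> F \<longleftrightarrow>
     (\<forall>X\<in>Ob T. \<exists>Y\<in>Ob T. \<exists>\<zeta>. natural_transformation A T (Ext_functor T \<phi> Y) F \<zeta> \<and>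
        (\<forall>d. \<zeta> X d ` carrier (deg (fun_ob (Ext_functor T \<phi> Y) X) d) = carrier (deg (fun_ob F X) d)))"

definition locally_finitely_presented ::
  "(int \<Rightarrow> 'r set) \<Rightarrow> ('o, 'm, 'z) tricat_scheme \<Rightarrow> (int \<Rightarrow> 'r \<Rightarrow> 'o \<Rightarrow> 'm) \<Rightarrow>
   ('o, 'm, 'r, 'n) gfun \<Rightarrow> bool" where
  "locally_finitely_presented A T \<phi> F \<longleftrightarrow>
     locally_finitely_generated A T \<phi> F \<and>
     (\<forall>Y\<in>Ob T. \<forall>\<zeta>. natural_transformation A T (Ext_functor T \<phi> Y) F \<zeta> \<longrightarrow>
        locally_finitely_generated A T \<phi> (kernel_functor (Ext_functor T \<phi> Y) F \<zeta>))"

end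

theory Submission
  imports Defs
begin

text \<open>
  Since \<open>F(X)\<^sub>d \<cong> F(\<Sigma>\<^sup>-\<^sup>d X)\<^sub>0\<close>, everything is determined by the cohomological functor \<open>H = F(-)\<^sub>0\<close>, and
  the ring enters only through the graded Yoneda lemma. Let \<open>G\<close> be a generator with
  \<open>thick\<^sup>n(G) = T\<close>. By finite presentation there is a sequence \<open>X\<^sub>0 \<rightarrow> X\<^sub>1 \<rightarrow> \<dots>\<close> with compatible
  \<open>f\<^sub>i : Hom(-, X\<^sub>i) \<rightarrow> H\<close> that are surjective on all \<open>\<Sigma>\<^sup>m G\<close> and such that \<open>ker f\<^sub>i\<close> vanishes in \<open>X\<^sub>i\<^sub>+\<^sub>1\<close> on
  all \<open>\<Sigma>\<^sup>m G\<close>: \<open>X\<^sub>i\<^sub>+\<^sub>1\<close> is the cone of a map \<open>W\<^sub>i \<rightarrow> X\<^sub>i\<close> covering the kernel. By induction on \<open>n\<close>,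
  on \<open>thick\<^sup>n(G)\<close> the map \<open>f\<^sub>i\<close> is surjective and \<open>ker f\<^sub>i\<close> vanishes in \<open>X\<^sub>i\<^sub>+\<^sub>n\<close> for all \<open>i \<ge> n\<close>.
  So \<open>H\<close> is the image of \<open>\<phi>\<^sub>* : Hom(-, X\<^sub>n) \<rightarrow> Hom(-, X\<^sub>2\<^sub>n)\<close>. Lifting \<open>f\<^sub>2\<^sub>n\<close> along \<open>f\<^sub>n\<close> to
  \<open>\<psi> : X\<^sub>2\<^sub>n \<rightarrow> X\<^sub>n\<close>, the map \<open>\<psi>\<phi>\<close> is idempotent and the summand of \<open>X\<^sub>n\<close> it splits off represents \<open>H\<close>.
\<close>

section \<open>Preadditive and triangulated categories\<close>

text \<open>Exactness and \<open>kills\<close> speak only of vanishing; equalities are reduced to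
  them through differences.\<close>

lemma (in group_hom) hom_diff_one_iff:
  assumes "x \<in> carrier G" "y \<in> carrier G"
  shows "h (x \<otimes> inv y) = \<one>\<^bsub>H\<^esub> \<longleftrightarrow> h x = h y"
proof -
  have "h (x \<otimes> inv y) = h x \<otimes>\<^bsub>H\<^esub> inv\<^bsub>H\<^esub> (h y)"
    using assms by simp
  moreover have "h x \<otimes>\<^bsub>H\<^esub> inv\<^bsub>H\<^esub> (h y) = \<one>\<^bsub>H\<^esub> \<longleftrightarrow> h x = h y"
    using assms H.inv_solve_right'[of "\<one>\<^bsub>H\<^esub>" "h x" "h y"] by auto
  ultimately show ?thesis
    by simp
qed

section \<open>Zero objects and biproducts\<close>

context preadditive_category
begin

lemma group_Hom: "\<lbrakk>X \<in> Ob T; Y \<in> Ob T\<rbrakk> \<Longrightarrow> group (Hom T X Y)"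
  using hom_group comm_group.axioms(2) by blast

lemma zero_closed: "\<lbrakk>X \<in> Ob T; Y \<in> Ob T\<rbrakk> \<Longrightarrow> \<one>\<^bsub>Hom T X Y\<^esub> \<in> Arr T X Y"
  by (rule monoid.one_closed[OF group.is_monoid[OF group_Hom]])

lemma add_closed:
  "\<lbrakk>X \<in> Ob T; Y \<in> Ob T; h \<in> Arr T X Y; k \<in> Arr T X Y\<rbrakk> \<Longrightarrow> h \<otimes>\<^bsub>Hom T X Y\<^esub> k \<in> Arr T X Y"
  by (rule monoid.m_closed[OF group.is_monoid[OF group_Hom]])

lemma diff_closed:
  "\<lbrakk>X \<in> Ob T; Y \<in> Ob T; h \<in> Arr T X Y; k \<in> Arr T X Y\<rbrakk>
    \<Longrightarrow> h \<otimes>\<^bsub>Hom T X Y\<^esub> inv\<^bsub>Hom T X Y\<^esub> k \<in> Arr T X Y"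
  using add_closed group.inv_closed[OF group_Hom] by simp

lemma post_comp_group_hom:
  "\<lbrakk>X \<in> Ob T; Y \<in> Ob T; Z \<in> Ob T; g \<in> Arr T Y Z\<rbrakk>
    \<Longrightarrow> group_hom (Hom T X Y) (Hom T X Z) (\<lambda>h. g \<cdot> h)"
  unfolding group_hom_def group_hom_axioms_def hom_def
  using group_Hom[of X Y] group_Hom[of X Z] comp_closed[of X Y Z g] comp_add_right[of X Y Z g] by auto

lemma pre_comp_group_hom:
  "\<lbrakk>X \<in> Ob T; Y \<in> Ob T; Z \<in> Ob T; h \<in> Arr T X Y\<rbrakk>
    \<Longrightarrow> group_hom (Hom T Y Z) (Hom T X Z) (\<lambda>g. g \<cdot> h)"
  unfolding group_hom_def group_hom_axioms_def hom_def
  using group_Hom[of Y Z] group_Hom[of X Z] comp_closed[of X Y Z _ h] comp_add_left[of X Y Z _ _ h] by auto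

lemma comp_zero_right:
  "\<lbrakk>X \<in> Ob T; Y \<in> Ob T; Z \<in> Ob T; g \<in> Arr T Y Z\<rbrakk> \<Longrightarrow> g \<cdot> \<one>\<^bsub>Hom T X Y\<^esub> = \<one>\<^bsub>Hom T X Z\<^esub>"
  using group_hom.hom_one[OF post_comp_group_hom] .

lemma comp_zero_left:
  "\<lbrakk>X \<in> Ob T; Y \<in> Ob T; Z \<in> Ob T; h \<in> Arr T X Y\<rbrakk> \<Longrightarrow> \<one>\<^bsub>Hom T Y Z\<^esub> \<cdot> h = \<one>\<^bsub>Hom T X Z\<^esub>"
  using group_hom.hom_one[OF pre_comp_group_hom] .

lemma zero_objectD:
  assumes "zero_object T Z" "X \<in> Ob T"
  shows "h \<in> Arr T X Z \<Longrightarrow> k \<in> Arr T X Z \<Longrightarrow> h = k"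
    and "h \<in> Arr T Z X \<Longrightarrow> k \<in> Arr T Z X \<Longrightarrow> h = k"
  using assms unfolding zero_object_def by blast+

text \<open>If the identity is zero, every map into or out of \<open>Z\<close> is a composite with
  zero. The criterion is an equation, so additive functors preserve it.\<close>

lemma zero_object_iff_id:
  assumes "Z \<in> Ob T"
  shows "zero_object T Z \<longleftrightarrow> Id T Z = \<one>\<^bsub>Hom T Z Z\<^esub>"
proof
  assume "zero_object T Z"
  then show "Id T Z = \<one>\<^bsub>Hom T Z Z\<^esub>"
    using assms zero_objectD(1) id_closed zero_closed by blast
next
  assume eq: "Id T Z = \<one>\<^bsub>Hom T Z Z\<^esub>"
  have "h = \<one>\<^bsub>Hom T X Z\<^esub>" if "X \<in> Ob T" "h \<in> Arr T X Z" for X h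
    using that assms eq id_left[of X Z h] comp_zero_left[of X Z Z h] by simp
  moreover have "h = \<one>\<^bsub>Hom T Z X\<^esub>" if "X \<in> Ob T" "h \<in> Arr T Z X" for X h
    using that assms eq id_right[of Z X h] comp_zero_right[of Z Z X h] by simp
  ultimately show "zero_object T Z"
    unfolding zero_object_def using assms zero_closed by metis
qed

text \<open>The projections come from the universal property applied to the pairs (identity, zero)
  and (zero, identity). The sum of the two idempotents and the identity have the same restrictions
  to \<open>X\<close> and \<open>Y\<close>, so uniqueness identifies them.\<close>

lemma coproduct_biproduct:
  assumes "X \<in> Ob T" "Y \<in> Ob T" "is_coproduct T X Y C i j"
  obtains p q where "p \<in> Arr T C X" "q \<in> Arr T C Y" "p \<cdot> i = Id T X"
    and "(i \<cdot> p) \<otimes>\<^bsub>Hom T C C\<^esub> (j \<cdot> q) = Id T C"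
proof -
  have C: "C \<in> Ob T" and i: "i \<in> Arr T X C" and j: "j \<in> Arr T Y C"
    and univ: "\<And>W f g. \<lbrakk>W \<in> Ob T; f \<in> Arr T X W; g \<in> Arr T Y W\<rbrakk> \<Longrightarrow>
      \<exists>!h. h \<in> Arr T C W \<and> h \<cdot> i = f \<and> h \<cdot> j = g"
    using assms(3) unfolding is_coproduct_def by auto
  obtain p where p: "p \<in> Arr T C X" "p \<cdot> i = Id T X" "p \<cdot> j = \<one>\<^bsub>Hom T Y X\<^esub>"
    using univ[of X "Id T X" "\<one>\<^bsub>Hom T Y X\<^esub>"] assms id_closed zero_closed by blast
  obtain q where q: "q \<in> Arr T C Y" "q \<cdot> i = \<one>\<^bsub>Hom T X Y\<^esub>" "q \<cdot> j = Id T Y"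
    using univ[of Y "\<one>\<^bsub>Hom T X Y\<^esub>" "Id T Y"] assms id_closed zero_closed by blast
  have ip: "i \<cdot> p \<in> Arr T C C" and jq: "j \<cdot> q \<in> Arr T C C"
    using comp_closed[OF C assms(1) C i p(1)] comp_closed[OF C assms(2) C j q(1)] by auto
  let ?s = "(i \<cdot> p) \<otimes>\<^bsub>Hom T C C\<^esub> (j \<cdot> q)"
  have s: "?s \<in> Arr T C C"
    using add_closed[OF C C ip jq] .
  have "?s \<cdot> i = ((i \<cdot> p) \<cdot> i) \<otimes>\<^bsub>Hom T X C\<^esub> ((j \<cdot> q) \<cdot> i)"
    using comp_add_left[of X C C _ _ i] C i ip jq assms by simp
  also have "(i \<cdot> p) \<cdot> i = i"
    using comp_assoc[of X C X C i p i] id_right[of X C i] C i p assms by simp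
  also have "(j \<cdot> q) \<cdot> i = \<one>\<^bsub>Hom T X C\<^esub>"
    using comp_assoc[of X C Y C j q i] comp_zero_right[of X Y C j] C i j q assms by simp
  finally have si: "?s \<cdot> i = i"
    using monoid.r_one[OF group.is_monoid[OF group_Hom[of X C]]] assms C i by simp
  have "?s \<cdot> j = ((i \<cdot> p) \<cdot> j) \<otimes>\<^bsub>Hom T Y C\<^esub> ((j \<cdot> q) \<cdot> j)"
    using comp_add_left[of Y C C _ _ j] C j ip jq assms by simp
  also have "(i \<cdot> p) \<cdot> j = \<one>\<^bsub>Hom T Y C\<^esub>"
    using comp_assoc[of Y C X C i p j] comp_zero_right[of Y X C i] C i j p assms by simp
  also have "(j \<cdot> q) \<cdot> j = j"
    using comp_assoc[of Y C Y C j q j] id_right[of Y C j] C j q assms by simp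
  finally have sj: "?s \<cdot> j = j"
    using monoid.l_one[OF group.is_monoid[OF group_Hom[of Y C]]] assms C j by simp
  have "Id T C \<cdot> i = i" "Id T C \<cdot> j = j"
    using id_left C i j assms by auto
  then have "?s = Id T C"
    using univ[OF C i j] s si sj id_closed[OF C] by blast
  with p q show thesis
    using that by blast
qed

end

section \<open>Suspension and exact triangles\<close>

context triangulated_category
begin

lemma susp_group_hom:
  "\<lbrakk>X \<in> Ob T; Y \<in> Ob T\<rbrakk>
    \<Longrightarrow> group_hom (Hom T X Y) (Hom T (susp_ob T n X) (susp_ob T n Y)) (susp T n)"
  unfolding group_hom_def group_hom_axioms_def
  using group_Hom[of X Y] group_Hom[of "susp_ob T n X" "susp_ob T n Y"] susp_hom susp_ob_closed by simp

lemma susp_closed: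
  "\<lbrakk>X \<in> Ob T; Y \<in> Ob T; h \<in> Arr T X Y\<rbrakk> \<Longrightarrow> susp T n h \<in> Arr T (susp_ob T n X) (susp_ob T n Y)"
  using group_hom.hom_closed[OF susp_group_hom] .

lemma susp_ob_cancel:
  assumes "X \<in> Ob T"
  shows "susp_ob T n (susp_ob T (- n) X) = X" and "susp_ob T (- n) (susp_ob T n X) = X"
  using susp_ob_add[OF assms, of n "- n"] susp_ob_add[OF assms, of "- n" n] susp_ob_zero[OF assms]
  by simp_all

lemma susp_cancel:
  assumes "X \<in> Ob T" "Y \<in> Ob T" "h \<in> Arr T X Y"
  shows "susp T n (susp T (- n) h) = h" and "susp T (- n) (susp T n h) = h"
  using susp_add[OF assms, of n "- n"] susp_add[OF assms, of "- n" n] susp_zero[OF assms]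
  by simp_all

lemma susp_bij_betw:
  assumes "X \<in> Ob T" "Y \<in> Ob T"
  shows "bij_betw (susp T n) (Arr T X Y) (Arr T (susp_ob T n X) (susp_ob T n Y))"
proof (rule bij_betw_byWitness[where f' = "susp T (- n)"])
  show "susp T (- n) ` Arr T (susp_ob T n X) (susp_ob T n Y) \<subseteq> Arr T X Y"
    using susp_closed[of "susp_ob T n X" "susp_ob T n Y" _ "- n"] susp_ob_closed susp_ob_cancel assms
    by auto
qed (use assms susp_closed susp_cancel(2) susp_ob_closed
    susp_cancel(1)[of "susp_ob T n X" "susp_ob T n Y"] in auto)

lemma zero_object_susp:
  assumes "zero_object T Z"
  shows "zero_object T (susp_ob T n Z)"
proof -
  have Z: "Z \<in> Ob T"
    using assms unfolding zero_object_def by blast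
  then have "Id T Z = \<one>\<^bsub>Hom T Z Z\<^esub>"
    using assms zero_object_iff_id by blast
  then have "Id T (susp_ob T n Z) = \<one>\<^bsub>Hom T (susp_ob T n Z) (susp_ob T n Z)\<^esub>"
    using susp_id[OF Z, of n] group_hom.hom_one[OF susp_group_hom[OF Z Z, of n]] by simp
  then show ?thesis
    using zero_object_iff_id susp_ob_closed[OF Z] by blast
qed

lemma rotate:
  assumes "exact_tri T X Y Z u v w"
  shows "exact_tri T Y Z (susp_ob T 1 X) v w (inv\<^bsub>Hom T (susp_ob T 1 X) (susp_ob T 1 Y)\<^esub> (susp T 1 u))"
  using assms TR2[of X Y Z u v w] tri_closed by blast

lemma rotate_back:
  assumes "exact_tri T X Y Z u v w"
  obtains w' where "exact_tri T (susp_ob T (-1) Z) X Y w' u v"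
proof -
  have o: "X \<in> Ob T" "Y \<in> Ob T" "Z \<in> Ob T"
    and m: "u \<in> Arr T X Y" "v \<in> Arr T Y Z" "w \<in> Arr T Z (susp_ob T 1 X)"
    using tri_closed[OF assms] by auto
  have Z: "susp_ob T 1 (susp_ob T (-1) Z) = Z" "susp_ob T (-1) Z \<in> Ob T"
    using o susp_ob_cancel[of Z 1] susp_ob_closed by auto
  have "susp_ob T (-1) (susp_ob T 1 X) = X"
    using o susp_ob_cancel by blast
  then have sw: "susp T (-1) w \<in> Arr T (susp_ob T (-1) Z) X"
    using susp_closed[of Z "susp_ob T 1 X" w "-1"] o m susp_ob_closed by simp
  \<comment> \<open>The sign cancels the one that \<open>TR2\<close> attaches to the suspended first
    map.\<close>
  let ?w = "inv\<^bsub>Hom T (susp_ob T (-1) Z) X\<^esub> (susp T (-1) w)"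
  have w': "?w \<in> Arr T (susp_ob T (-1) Z) X"
    using group.inv_closed[OF group_Hom] sw Z o by simp
  have "susp T 1 ?w = inv\<^bsub>Hom T Z (susp_ob T 1 X)\<^esub> (susp T 1 (susp T (-1) w))"
    using group_hom.hom_inv[OF susp_group_hom[of "susp_ob T (-1) Z" X 1] sw] Z o by simp
  also have "susp T 1 (susp T (-1) w) = w"
    using susp_cancel(1)[of Z "susp_ob T 1 X" w 1] o m susp_ob_closed by simp
  finally have "inv\<^bsub>Hom T Z (susp_ob T 1 X)\<^esub> (susp T 1 ?w) = w"
    using group.inv_inv[OF group_Hom[of Z "susp_ob T 1 X"]] o m susp_ob_closed by simp
  then have "exact_tri T (susp_ob T (-1) Z) X Y ?w u v"
    using TR2[of "susp_ob T (-1) Z" X Y ?w u v] assms o m w' Z by simp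
  then show thesis
    using that by blast
qed

text \<open>Rotating three times forwards or backwards moves all three objects by one suspension.
  The maps are existentially quantified, so their signs need no tracking.\<close>

lemma exact_tri_susp:
  assumes "exact_tri T X Y Z u v w"
  shows "\<exists>u' v' w'. exact_tri T (susp_ob T n X) (susp_ob T n Y) (susp_ob T n Z) u' v' w'"
proof (induction n rule: int_induct[where k = 0])
  case base
  then show ?case
    using assms tri_closed[OF assms] susp_ob_zero by auto
next
  case (step1 n)
  then obtain u' v' w' where
    "exact_tri T (susp_ob T n X) (susp_ob T n Y) (susp_ob T n Z) u' v' w'"
    by blast
  from rotate[OF rotate[OF rotate[OF this]]] show ?case
    using tri_closed[OF assms] susp_ob_add[of _ 1 n] by (auto simp: add.commute)
next
  case (step2 n)
  then obtain u' v' w' where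
    "exact_tri T (susp_ob T n X) (susp_ob T n Y) (susp_ob T n Z) u' v' w'"
    by blast
  then have "\<exists>u' v' w'. exact_tri T (susp_ob T (-1) (susp_ob T n X))
      (susp_ob T (-1) (susp_ob T n Y)) (susp_ob T (-1) (susp_ob T n Z)) u' v' w'"
    by (meson rotate_back)
  then show ?case
    using tri_closed[OF assms] susp_ob_add[of _ "-1" n] by simp
qed

lemma exact_tri_comp_zero:
  assumes "exact_tri T X Y Z u v w"
  shows "v \<cdot> u = \<one>\<^bsub>Hom T X Z\<^esub>"
proof -
  have o: "X \<in> Ob T" "Y \<in> Ob T" "Z \<in> Ob T" and m: "u \<in> Arr T X Y"
    using tri_closed[OF assms] by auto
  obtain O' where O': "zero_object T O'"
    using has_zero by blast
  then have O'_ob: "O' \<in> Ob T"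
    unfolding zero_object_def by blast
  \<comment> \<open>\<open>TR3\<close> compares the triangle \<open>X -> X -> 0\<close> with the
    given one, so \<open>v \<cdot> u\<close> factors through a zero object.\<close>
  obtain c where "c \<in> Arr T O' Z" "c \<cdot> \<one>\<^bsub>Hom T X O'\<^esub> = v \<cdot> u"
    using TR3[OF TR1_id[OF o(1) O'] assms id_closed[OF o(1)] m] by blast
  then show ?thesis
    using comp_zero_right O'_ob o by metis
qed

text \<open>Exactness of Hom into \<open>W\<close>: together with the zero map from \<open>X\<close>
  to \<open>O'\<close>, \<open>f\<close> starts a map to the triangle \<open>O' -> W -> W\<close>,
  and \<open>TR3\<close> completes it.\<close>

lemma exact_tri_factor:
  assumes tri: "exact_tri T X Y Z u v w"
    and W: "W \<in> Ob T" and f: "f \<in> Arr T Y W" and fu: "f \<cdot> u = \<one>\<^bsub>Hom T X W\<^esub>"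
  obtains g where "g \<in> Arr T Z W" "f = g \<cdot> v"
proof -
  have o: "X \<in> Ob T" "Y \<in> Ob T" "Z \<in> Ob T"
    using tri_closed[OF tri] by auto
  obtain O' where O': "zero_object T O'"
    using has_zero by blast
  then have O'_ob: "O' \<in> Ob T"
    unfolding zero_object_def by blast
  note SO = zero_object_susp[OF O', of 1]
  let ?z = "\<one>\<^bsub>Hom T O' W\<^esub>" and ?y = "\<one>\<^bsub>Hom T W (susp_ob T 1 O')\<^esub>"
  have "susp T 1 ?z = \<one>\<^bsub>Hom T (susp_ob T 1 O') (susp_ob T 1 W)\<^esub>"
    using group_hom.hom_one[OF susp_group_hom] O'_ob W by blast
  then have "inv\<^bsub>Hom T (susp_ob T 1 O') (susp_ob T 1 W)\<^esub> (susp T 1 ?z)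
      = \<one>\<^bsub>Hom T (susp_ob T 1 O') (susp_ob T 1 W)\<^esub>"
    using monoid.inv_one[OF group.is_monoid[OF group_Hom]] susp_ob_closed O'_ob W by simp
  \<comment> \<open>The rotation of this triangle is \<open>W -> W -> \<Sigma>O'\<close>, which
    \<open>TR1_id\<close> provides because the suspension of \<open>O'\<close> is again a zero
    object.\<close>
  then have tri': "exact_tri T O' W W ?z (Id T W) ?y"
    using TR2[of O' W W ?z "Id T W" ?y] TR1_id[OF W SO] O'_ob W zero_closed id_closed susp_ob_closed
    by simp
  have "f \<cdot> u = ?z \<cdot> \<one>\<^bsub>Hom T X O'\<^esub>"
    using fu comp_zero_left zero_closed o O'_ob W by simp
  then obtain c where "c \<in> Arr T Z W" "c \<cdot> v = Id T W \<cdot> f"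
    using TR3[OF tri tri' zero_closed[OF o(1) O'_ob] f] by blast
  then show thesis
    using that id_left f o W by metis
qed

section \<open>Induction over \<open>thick1\<close>\<close>

text \<open>
  Closure under finite coproducts is tested on idempotent decompositions of the identity, which
  every additive functor preserves.
\<close>

lemma thick1_susp_induct [consumes 2, case_names generator zero coproduct retract]:
  assumes Z: "Z \<in> thick1 T G" and G: "G \<in> Ob T"
    and gen: "\<And>m. Q (susp_ob T m G)"
    and zer: "\<And>V. \<lbrakk>V \<in> Ob T; Id T V = \<one>\<^bsub>Hom T V V\<^esub>\<rbrakk> \<Longrightarrow> Q V"
    and sum: "\<And>X Y C i j p q. \<lbrakk>X \<in> Ob T; Y \<in> Ob T; C \<in> Ob T; Q X; Q Y; i \<in> Arr T X C;
      j \<in> Arr T Y C; p \<in> Arr T C X; q \<in> Arr T C Y;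
      (i \<cdot> p) \<otimes>\<^bsub>Hom T C C\<^esub> (j \<cdot> q) = Id T C\<rbrakk> \<Longrightarrow> Q C"
    and ret: "\<And>X Y i p. \<lbrakk>X \<in> Ob T; Y \<in> Ob T; Q Y; i \<in> Arr T X Y; p \<in> Arr T Y X;
      p \<cdot> i = Id T X\<rbrakk> \<Longrightarrow> Q X"
  shows "Z \<in> Ob T \<and> (\<forall>m. Q (susp_ob T m Z))"
  using Z
proof (induction rule: thick1.induct)
  case generator
  then show ?case using G gen by blast
next
  case (zero Z)
  then have "Z \<in> Ob T"
    unfolding zero_object_def by blast
  then show ?case
    using zero_object_susp[OF zero] zero_object_iff_id zer susp_ob_closed by blast
next
  case (coproduct X Y C i j)
  then have XY: "X \<in> Ob T" "Y \<in> Ob T" by auto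
  have C: "C \<in> Ob T" "i \<in> Arr T X C" "j \<in> Arr T Y C"
    using coproduct.hyps unfolding is_coproduct_def by auto
  obtain p q where pq: "p \<in> Arr T C X" "q \<in> Arr T C Y"
    and eq: "(i \<cdot> p) \<otimes>\<^bsub>Hom T C C\<^esub> (j \<cdot> q) = Id T C"
    using coproduct_biproduct[OF XY coproduct.hyps(3)] by blast
  have "Q (susp_ob T m C)" for m
  proof (rule sum[where X = "susp_ob T m X" and Y = "susp_ob T m Y"])
    show "(susp T m i \<cdot> susp T m p) \<otimes>\<^bsub>Hom T (susp_ob T m C) (susp_ob T m C)\<^esub>
        (susp T m j \<cdot> susp T m q) = Id T (susp_ob T m C)"
      using group_hom.hom_mult[OF susp_group_hom[of C C m], of "i \<cdot> p" "j \<cdot> q"]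
        susp_comp[of C X C i p m] susp_comp[of C Y C j q m] comp_closed[of C X C i p]
        comp_closed[of C Y C j q] susp_id[of C m] eq XY C pq by simp
  qed (use coproduct XY C pq susp_closed susp_ob_closed in auto)
  then show ?case using C by blast
next
  case (retract Y X)
  then obtain i p where ip: "X \<in> Ob T" "Y \<in> Ob T" "i \<in> Arr T X Y" "p \<in> Arr T Y X" "p \<cdot> i = Id T X"
    unfolding is_retract_def by blast
  have "Q (susp_ob T m X)" for m
  proof (rule ret[where Y = "susp_ob T m Y"])
    show "susp T m p \<cdot> susp T m i = Id T (susp_ob T m X)"
      using susp_comp[of X Y X p i m] susp_id[of X m] ip by simp
  qed (use retract ip susp_closed susp_ob_closed in auto)
  then show ?case using ip by blast
next
  case (suspension X n)
  \<comment> \<open>The conclusion ranges over all \<open>m\<close>, so suspending \<open>X\<close>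
    merely shifts the index, and the rule has no suspension case.\<close>
  have "susp_ob T m (susp_ob T n X) = susp_ob T (m + n) X" for m
    using susp_ob_add suspension.IH by simp
  then show ?case
    using suspension.IH susp_ob_closed by simp
qed

end

section \<open>Ungraded cohomological functors\<close>

text \<open>Of exactness only the inclusion of the kernel in the image at the middle term is
  recorded: the other inclusion follows from \<open>exact_tri_comp_zero\<close>, the other terms of
  the long sequence from rotation.\<close>

locale cohomological_functor = triangulated_category T
  for T :: "('o, 'm, 'z) tricat_scheme" (structure) +
  fixes H :: "'o \<Rightarrow> 'n monoid" and hm :: "'m \<Rightarrow> 'n \<Rightarrow> 'n"
  assumes value_group: "X \<in> Ob T \<Longrightarrow> group (H X)"
    and map_hom: "\<lbrakk>X \<in> Ob T; Y \<in> Ob T; h \<in> Arr T X Y\<rbrakk> \<Longrightarrow> hm h \<in> hom (H Y) (H X)"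
    and map_id: "\<lbrakk>X \<in> Ob T; x \<in> carrier (H X)\<rbrakk> \<Longrightarrow> hm (Id T X) x = x"
    and map_comp: "\<lbrakk>X \<in> Ob T; Y \<in> Ob T; Z \<in> Ob T; g \<in> Arr T Y Z; h \<in> Arr T X Y;
      x \<in> carrier (H Z)\<rbrakk> \<Longrightarrow> hm (g \<cdot> h) x = hm h (hm g x)"
    and map_add: "\<lbrakk>X \<in> Ob T; Y \<in> Ob T; h \<in> Arr T X Y; h' \<in> Arr T X Y; x \<in> carrier (H Y)\<rbrakk> \<Longrightarrow>
      hm (h \<otimes>\<^bsub>Hom T X Y\<^esub> h') x = hm h x \<otimes>\<^bsub>H X\<^esub> hm h' x"
    and exact: "\<lbrakk>exact_tri T X Y Z u v w; y \<in> carrier (H Y); hm u y = \<one>\<^bsub>H X\<^esub>\<rbrakk> \<Longrightarrow>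
      \<exists>z\<in>carrier (H Z). hm v z = y"

primrec chain :: "('o, 'm, 'z) precat_scheme \<Rightarrow> (nat \<Rightarrow> 'o) \<Rightarrow> (nat \<Rightarrow> 'm) \<Rightarrow> nat \<Rightarrow> nat \<Rightarrow> 'm" where
  "chain T X \<phi> i 0 = Id T (X i)"
| "chain T X \<phi> i (Suc n) = \<phi> (i + n) \<cdot>\<^bsub>T\<^esub> chain T X \<phi> i n"

context cohomological_functor
begin

lemma map_closed:
  "\<lbrakk>X \<in> Ob T; Y \<in> Ob T; h \<in> Arr T X Y; x \<in> carrier (H Y)\<rbrakk> \<Longrightarrow> hm h x \<in> carrier (H X)"
  using hom_in_carrier[OF map_hom] .

lemma map_group_hom:
  "\<lbrakk>X \<in> Ob T; Y \<in> Ob T; h \<in> Arr T X Y\<rbrakk> \<Longrightarrow> group_hom (H Y) (H X) (hm h)"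
  unfolding group_hom_def group_hom_axioms_def
  using value_group[of X] value_group[of Y] map_hom[of X Y h] by simp

lemma eval_group_hom:
  "\<lbrakk>X \<in> Ob T; Y \<in> Ob T; x \<in> carrier (H Y)\<rbrakk> \<Longrightarrow> group_hom (Hom T X Y) (H X) (\<lambda>h. hm h x)"
  unfolding group_hom_def group_hom_axioms_def hom_def
  using value_group[of X] group_Hom[of X Y] map_closed[of X Y _ x] map_add[of X Y _ _ x] by auto

lemma map_one: "\<lbrakk>X \<in> Ob T; Y \<in> Ob T; h \<in> Arr T X Y\<rbrakk> \<Longrightarrow> hm h \<one>\<^bsub>H Y\<^esub> = \<one>\<^bsub>H X\<^esub>"
  using group_hom.hom_one[OF map_group_hom] .

lemma map_zero:
  "\<lbrakk>X \<in> Ob T; Y \<in> Ob T; x \<in> carrier (H Y)\<rbrakk> \<Longrightarrow> hm \<one>\<^bsub>Hom T X Y\<^esub> x = \<one>\<^bsub>H X\<^esub>"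
  using group_hom.hom_one[OF eval_group_hom] .

section \<open>Surjectivity and killed kernels on retracts, on \<open>thick1\<close> and along
  triangles\<close>

text \<open>
  An element \<open>x\<close> of \<open>H X\<close> is a natural transformation \<open>Hom(-,X) \<rightarrow> H\<close>. It is surjective at \<open>V\<close>
  if \<open>epi_at X x V\<close>, and its kernel at \<open>V\<close> is annihilated by \<open>\<phi> : X \<rightarrow> Y\<close> if \<open>kills X x Y \<phi> V\<close>.
\<close>

definition epi_at :: "'o \<Rightarrow> 'n \<Rightarrow> 'o \<Rightarrow> bool" where
  "epi_at X x V \<longleftrightarrow> (\<forall>z\<in>carrier (H V). \<exists>h\<in>Arr T V X. hm h x = z)"

definition kills :: "'o \<Rightarrow> 'n \<Rightarrow> 'o \<Rightarrow> 'm \<Rightarrow> 'o \<Rightarrow> bool" where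
  "kills X x Y \<phi> V \<longleftrightarrow> (\<forall>h\<in>Arr T V X. hm h x = \<one>\<^bsub>H V\<^esub> \<longrightarrow> \<phi> \<cdot> h = \<one>\<^bsub>Hom T V Y\<^esub>)"

text \<open>Pull \<open>z\<close> back along \<open>p\<close>, lift it over \<open>C\<close>, and
  restrict the lift along \<open>i\<close>.\<close>

lemma epi_at_retract:
  assumes o: "X \<in> Ob T" "V \<in> Ob T" "C \<in> Ob T" and x: "x \<in> carrier (H X)"
    and ip: "i \<in> Arr T V C" "p \<in> Arr T C V" "p \<cdot> i = Id T V" and epi: "epi_at X x C"
  shows "epi_at X x V"
  unfolding epi_at_def
proof
  fix z assume z: "z \<in> carrier (H V)"
  then have "hm p z \<in> carrier (H C)"
    using map_closed[of C V p z] o ip by simp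
  then obtain h where h: "h \<in> Arr T C X" "hm h x = hm p z"
    using epi unfolding epi_at_def by blast
  have "hm (h \<cdot> i) x = hm i (hm p z)"
    using map_comp[of V C X h i x] o x ip h by simp
  also have "\<dots> = z"
    using map_comp[of V C V p i z] map_id[of V z] o ip z by simp
  finally show "\<exists>h\<in>Arr T V X. hm h x = z"
    using comp_closed[of V C X h i] o ip h by auto
qed

lemma kills_retract:
  assumes o: "X \<in> Ob T" "Y \<in> Ob T" "V \<in> Ob T" "C \<in> Ob T" and x: "x \<in> carrier (H X)"
    and \<phi>: "\<phi> \<in> Arr T X Y"
    and ip: "i \<in> Arr T V C" "p \<in> Arr T C V" "p \<cdot> i = Id T V" and kills: "kills X x Y \<phi> C"
  shows "kills X x Y \<phi> V"
  unfolding kills_def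
proof (intro ballI impI)
  fix h assume h: "h \<in> Arr T V X" "hm h x = \<one>\<^bsub>H V\<^esub>"
  have hp: "h \<cdot> p \<in> Arr T C X"
    using comp_closed[of C V X h p] o ip h by simp
  have "hm (h \<cdot> p) x = \<one>\<^bsub>H C\<^esub>"
    using map_comp[of C V X h p x] map_one[of C V p] o x ip h by simp
  then have z: "\<phi> \<cdot> h \<cdot> p = \<one>\<^bsub>Hom T C Y\<^esub>"
    using hp kills unfolding kills_def by blast
  have "\<phi> \<cdot> h = \<phi> \<cdot> h \<cdot> p \<cdot> i"
    using id_right[of V X h] o ip h by simp
  also have "\<dots> = (\<phi> \<cdot> h \<cdot> p) \<cdot> i"
    using comp_assoc[of V C X Y \<phi> "h \<cdot> p" i] comp_assoc[of V C V X h p i] o \<phi> hp ip h by simp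
  also have "\<dots> = \<one>\<^bsub>Hom T V Y\<^esub>"
    using z comp_zero_left[of V C Y i] o ip by simp
  finally show "\<phi> \<cdot> h = \<one>\<^bsub>Hom T V Y\<^esub>" .
qed

lemma thick1_epi_at:
  assumes "Z \<in> thick1 T G" "G \<in> Ob T" and X: "X \<in> Ob T" "x \<in> carrier (H X)"
    and "\<And>m. epi_at X x (susp_ob T m G)"
  shows "epi_at X x (susp_ob T m Z)"
proof -
  have "Z \<in> Ob T \<and> (\<forall>m. epi_at X x (susp_ob T m Z))"
    using assms(1,2)
  proof (induction rule: thick1_susp_induct)
    case (generator m)
    then show ?case using assms by blast
  next
    case (zero V)
    have "z = \<one>\<^bsub>H V\<^esub>" if "z \<in> carrier (H V)" for z
      using map_id[of V z] map_zero[of V V z] zero that by simp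
    then show ?case
      unfolding epi_at_def using map_zero[of V X x] zero_closed[of V X] zero X by blast
  next
    case (coproduct V W C i j p q)
    show ?case
      unfolding epi_at_def
    proof
      fix z assume z: "z \<in> carrier (H C)"
      then have "hm i z \<in> carrier (H V)" "hm j z \<in> carrier (H W)"
        using map_closed[of V C i z] map_closed[of W C j z] coproduct by auto
      then obtain h k where hk: "h \<in> Arr T V X" "hm h x = hm i z" "k \<in> Arr T W X" "hm k x = hm j z"
        using coproduct unfolding epi_at_def by blast
      have hp: "h \<cdot> p \<in> Arr T C X" and kq: "k \<cdot> q \<in> Arr T C X"
        and ip: "i \<cdot> p \<in> Arr T C C" and jq: "j \<cdot> q \<in> Arr T C C"
        using comp_closed[of C V X h p] comp_closed[of C W X k q] comp_closed[of C V C i p]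
          comp_closed[of C W C j q] coproduct hk X by auto
      \<comment> \<open>The lifts on the two summands are glued along the projections; the
        decomposition of the identity shows that the result lifts \<open>z\<close>.\<close>
      have "hm ((h \<cdot> p) \<otimes>\<^bsub>Hom T C X\<^esub> (k \<cdot> q)) x = hm p (hm i z) \<otimes>\<^bsub>H C\<^esub> hm q (hm j z)"
        using map_add[of C X "h \<cdot> p" "k \<cdot> q" x] map_comp[of C V X h p x] map_comp[of C W X k q x]
          coproduct hk X hp kq by simp
      also have "\<dots> = hm ((i \<cdot> p) \<otimes>\<^bsub>Hom T C C\<^esub> (j \<cdot> q)) z"
        using map_add[of C C "i \<cdot> p" "j \<cdot> q" z] map_comp[of C V C i p z] map_comp[of C W C j q z]
          coproduct z ip jq by simp
      also have "\<dots> = z"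
        using map_id[of C z] coproduct z by simp
      finally show "\<exists>h\<in>Arr T C X. hm h x = z"
        using add_closed[of C X "h \<cdot> p" "k \<cdot> q"] coproduct hp kq X by blast
    qed
  next
    case (retract V C i p)
    then show ?case
      using epi_at_retract[of X V C x i p] X by simp
  qed
  then show ?thesis by blast
qed

lemma thick1_kills:
  assumes "Z \<in> thick1 T G" "G \<in> Ob T"
    and X: "X \<in> Ob T" "Y \<in> Ob T" "x \<in> carrier (H X)" "\<phi> \<in> Arr T X Y"
    and "\<And>m. kills X x Y \<phi> (susp_ob T m G)"
  shows "kills X x Y \<phi> (susp_ob T m Z)"
proof -
  have "Z \<in> Ob T \<and> (\<forall>m. kills X x Y \<phi> (susp_ob T m Z))"
    using assms(1,2)
  proof (induction rule: thick1_susp_induct)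
    case (generator m)
    then show ?case using assms by blast
  next
    case (zero V)
    then show ?case
      unfolding kills_def
      using zero_objectD(2)[of V X] zero_object_iff_id[of V] zero_closed[of V X]
        comp_zero_right[of V X Y \<phi>] X by metis
  next
    case (coproduct V W C i j p q)
    show ?case
      unfolding kills_def
    proof (intro ballI impI)
      fix h assume h: "h \<in> Arr T C X" "hm h x = \<one>\<^bsub>H C\<^esub>"
      have hi: "h \<cdot> i \<in> Arr T V X" and hj: "h \<cdot> j \<in> Arr T W X"
        and ip: "i \<cdot> p \<in> Arr T C C" and jq: "j \<cdot> q \<in> Arr T C C" and \<phi>h: "\<phi> \<cdot> h \<in> Arr T C Y"
        using comp_closed[of V C X h i] comp_closed[of W C X h j] comp_closed[of C V C i p]
          comp_closed[of C W C j q] comp_closed[of C X Y \<phi> h] coproduct h X by auto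
      have "hm (h \<cdot> i) x = \<one>\<^bsub>H V\<^esub>" "hm (h \<cdot> j) x = \<one>\<^bsub>H W\<^esub>"
        using map_comp[of V C X h i x] map_one[of V C i] map_comp[of W C X h j x] map_one[of W C j]
          coproduct h X by auto
      then have z: "(\<phi> \<cdot> h) \<cdot> i = \<one>\<^bsub>Hom T V Y\<^esub>" "(\<phi> \<cdot> h) \<cdot> j = \<one>\<^bsub>Hom T W Y\<^esub>"
        using coproduct hi hj h X comp_assoc[of V C X Y \<phi> h i] comp_assoc[of W C X Y \<phi> h j]
        unfolding kills_def by auto
      \<comment> \<open>Splitting the identity reduces the claim to the restrictions of
        \<open>h\<close> to the summands, both of which lie in the kernel.\<close>
      have "\<phi> \<cdot> h = (\<phi> \<cdot> h) \<cdot> ((i \<cdot> p) \<otimes>\<^bsub>Hom T C C\<^esub> (j \<cdot> q))"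
        using id_right[of C Y "\<phi> \<cdot> h"] coproduct \<phi>h X by simp
      also have "\<dots> = ((\<phi> \<cdot> h) \<cdot> i \<cdot> p) \<otimes>\<^bsub>Hom T C Y\<^esub> ((\<phi> \<cdot> h) \<cdot> j \<cdot> q)"
        using comp_add_right[of C C Y "\<phi> \<cdot> h" "i \<cdot> p" "j \<cdot> q"] coproduct \<phi>h X ip jq by simp
      also have "(\<phi> \<cdot> h) \<cdot> i \<cdot> p = \<one>\<^bsub>Hom T C Y\<^esub>"
        using comp_assoc[of C V C Y "\<phi> \<cdot> h" i p] z comp_zero_left[of C V Y p] coproduct \<phi>h X by simp
      also have "(\<phi> \<cdot> h) \<cdot> j \<cdot> q = \<one>\<^bsub>Hom T C Y\<^esub>"
        using comp_assoc[of C W C Y "\<phi> \<cdot> h" j q] z comp_zero_left[of C W Y q] coproduct \<phi>h X by simp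
      also have "\<one>\<^bsub>Hom T C Y\<^esub> \<otimes>\<^bsub>Hom T C Y\<^esub> \<one>\<^bsub>Hom T C Y\<^esub> = \<one>\<^bsub>Hom T C Y\<^esub>"
        using monoid.l_one[OF group.is_monoid[OF group_Hom[of C Y]]] zero_closed[of C Y] coproduct X
        by simp
      finally show "\<phi> \<cdot> h = \<one>\<^bsub>Hom T C Y\<^esub>" .
    qed
  next
    case (retract V C i p)
    then show ?case
      using kills_retract[of X Y V C x \<phi> i p] X by simp
  qed
  then show ?thesis by blast
qed

text \<open>A four lemma chase in which \<open>\<phi>\<close> replaces injectivity at the
  desuspension of \<open>C\<close>: a lift of \<open>hm u z\<close> over \<open>A\<close> extends to
  \<open>B\<close> after it is pushed to \<open>Y\<close>, and the remaining error vanishes on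
  \<open>A\<close>, so it is corrected from \<open>C\<close>.\<close>

lemma epi_at_triangle:
  assumes tri: "exact_tri T A B C u v w"
    and X: "X \<in> Ob T" "Y \<in> Ob T" "x \<in> carrier (H X)" "y \<in> carrier (H Y)"
    and \<phi>: "\<phi> \<in> Arr T X Y" "hm \<phi> y = x"
    and epiA: "epi_at X x A" and killsC: "kills X x Y \<phi> (susp_ob T (-1) C)" and epiC: "epi_at Y y C"
  shows "epi_at Y y B"
  unfolding epi_at_def
proof
  have o: "A \<in> Ob T" "B \<in> Ob T" "C \<in> Ob T" and m: "u \<in> Arr T A B" "v \<in> Arr T B C"
    using tri_closed[OF tri] by auto
  obtain w' where tri': "exact_tri T (susp_ob T (-1) C) A B w' u v"
    using rotate_back[OF tri] by blast
  let ?D = "susp_ob T (-1) C"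
  have D: "?D \<in> Ob T" and w': "w' \<in> Arr T ?D A"
    using tri_closed[OF tri'] by auto
  fix z assume z: "z \<in> carrier (H B)"
  then have "hm u z \<in> carrier (H A)"
    using map_closed[of A B u z] o m by simp
  then obtain a where a: "a \<in> Arr T A X" "hm a x = hm u z"
    using epiA unfolding epi_at_def by blast
  have aw: "a \<cdot> w' \<in> Arr T ?D X"
    using comp_closed[of ?D A X a w'] D o w' a X by simp
  \<comment> \<open>\<open>a \<cdot> w'\<close> is the obstruction to extending \<open>a\<close>
    along \<open>u\<close>.\<close>
  have "hm (a \<cdot> w') x = hm (u \<cdot> w') z"
    using map_comp[of ?D A X a w' x] map_comp[of ?D A B u w' z] D o w' a X m z by simp
  also have "\<dots> = \<one>\<^bsub>H ?D\<^esub>"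
    using exact_tri_comp_zero[OF tri'] map_zero[of ?D B z] D o z by simp
  finally have "\<phi> \<cdot> a \<cdot> w' = \<one>\<^bsub>Hom T ?D Y\<^esub>"
    using killsC aw unfolding kills_def by blast
  then have "(\<phi> \<cdot> a) \<cdot> w' = \<one>\<^bsub>Hom T ?D Y\<^esub>"
    using comp_assoc[of ?D A X Y \<phi> a w'] D o X \<phi> a w' by simp
  moreover have \<phi>a: "\<phi> \<cdot> a \<in> Arr T A Y"
    using comp_closed[of A X Y \<phi> a] o X \<phi> a by simp
  ultimately obtain b where b: "b \<in> Arr T B Y" "\<phi> \<cdot> a = b \<cdot> u"
    using exact_tri_factor[OF tri' X(2)] by blast
  have by_closed: "hm b y \<in> carrier (H B)"
    using map_closed[of B Y b y] o X b by simp
  have "hm u (hm b y) = hm (\<phi> \<cdot> a) y"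
    using map_comp[of A B Y b u y] o X b m by simp
  also have "\<dots> = hm u z"
    using map_comp[of A X Y \<phi> a y] o X \<phi> a by simp
  finally have "hm u (hm b y \<otimes>\<^bsub>H B\<^esub> inv\<^bsub>H B\<^esub> z) = \<one>\<^bsub>H A\<^esub>"
    using group_hom.hom_diff_one_iff[OF map_group_hom[of A B u]] o m by_closed z by simp
  moreover have "hm b y \<otimes>\<^bsub>H B\<^esub> inv\<^bsub>H B\<^esub> z \<in> carrier (H B)"
    using value_group[OF o(2)] by_closed z by (simp add: group.inv_closed group.is_monoid monoid.m_closed)
  ultimately obtain c' where c': "c' \<in> carrier (H C)" "hm v c' = hm b y \<otimes>\<^bsub>H B\<^esub> inv\<^bsub>H B\<^esub> z"
    using exact[OF tri] by blast
  obtain c where c: "c \<in> Arr T C Y" "hm c y = c'"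
    using epiC c' unfolding epi_at_def by blast
  have cv: "c \<cdot> v \<in> Arr T B Y" "hm (c \<cdot> v) y = hm b y \<otimes>\<^bsub>H B\<^esub> inv\<^bsub>H B\<^esub> z"
    using comp_closed[of B C Y c v] map_comp[of B C Y c v y] o m c c' X by auto
  interpret HB: group "H B"
    using value_group o by blast
  interpret HBc: group_hom "Hom T B Y" "H B" "\<lambda>h. hm h y"
    using eval_group_hom o X by blast
  \<comment> \<open>In this order the terms cancel without commutativity, as \<open>H B\<close> is
    only known to be a group.\<close>
  have "hm (inv\<^bsub>Hom T B Y\<^esub> (c \<cdot> v) \<otimes>\<^bsub>Hom T B Y\<^esub> b) y
      = inv\<^bsub>H B\<^esub> (hm b y \<otimes>\<^bsub>H B\<^esub> inv\<^bsub>H B\<^esub> z) \<otimes>\<^bsub>H B\<^esub> hm b y"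
    using cv b by simp
  also have "\<dots> = z"
    using by_closed z by (simp add: HB.inv_mult_group HB.m_assoc)
  finally show "\<exists>h\<in>Arr T B Y. hm h y = z"
    using cv b by blast
qed

text \<open>\<open>\<tau>\<close> makes \<open>b\<close> factor through \<open>C\<close>, and
  \<open>\<phi>\<close> kills the factor once it is corrected by a map through the suspension of
  \<open>A\<close>. An extension thus spends two killing maps, one for each end.\<close>

lemma kills_triangle:
  assumes tri: "exact_tri T A B C u v w"
    and X: "X \<in> Ob T" "Y \<in> Ob T" "Z \<in> Ob T" "x \<in> carrier (H X)" "y \<in> carrier (H Y)"
    and \<tau>: "\<tau> \<in> Arr T X Y" "hm \<tau> y = x" and \<phi>: "\<phi> \<in> Arr T Y Z"
    and killsA: "kills X x Y \<tau> A" and epiA: "epi_at Y y (susp_ob T 1 A)" and killsC: "kills Y y Z \<phi> C"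
  shows "kills X x Z (\<phi> \<cdot> \<tau>) B"
  unfolding kills_def
proof (intro ballI impI)
  have o: "A \<in> Ob T" "B \<in> Ob T" "C \<in> Ob T" "susp_ob T 1 A \<in> Ob T"
    and m: "u \<in> Arr T A B" "v \<in> Arr T B C" "w \<in> Arr T C (susp_ob T 1 A)"
    using tri_closed[OF tri] susp_ob_closed by auto
  note tri' = rotate[OF tri]
  fix b assume b: "b \<in> Arr T B X" "hm b x = \<one>\<^bsub>H B\<^esub>"
  have bu: "b \<cdot> u \<in> Arr T A X" and \<tau>b: "\<tau> \<cdot> b \<in> Arr T B Y"
    using comp_closed[of A B X b u] comp_closed[of B X Y \<tau> b] o m X \<tau> b by auto
  have "hm (b \<cdot> u) x = \<one>\<^bsub>H A\<^esub>"
    using map_comp[of A B X b u x] map_one[of A B u] o m X b by simp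
  then have "\<tau> \<cdot> b \<cdot> u = \<one>\<^bsub>Hom T A Y\<^esub>"
    using killsA bu unfolding kills_def by blast
  then have "(\<tau> \<cdot> b) \<cdot> u = \<one>\<^bsub>Hom T A Y\<^esub>"
    using comp_assoc[of A B X Y \<tau> b u] o m X \<tau> b by simp
  then obtain c where c: "c \<in> Arr T C Y" "\<tau> \<cdot> b = c \<cdot> v"
    using exact_tri_factor[OF tri X(2) \<tau>b] by blast
  have cy: "hm c y \<in> carrier (H C)"
    using map_closed[of C Y c y] o X c by simp
  have "hm v (hm c y) = hm (\<tau> \<cdot> b) y"
    using map_comp[of B C Y c v y] o m X c by simp
  also have "\<dots> = \<one>\<^bsub>H B\<^esub>"
    using map_comp[of B X Y \<tau> b y] o m X \<tau> b by simp
  \<comment> \<open>\<open>hm c y\<close> vanishes on \<open>B\<close>, so by the rotated triangle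
    it comes from the suspension of \<open>A\<close>. A lift \<open>\<alpha>\<close> of this
    preimage makes \<open>c - \<alpha> \<cdot> w\<close> a kernel element.\<close>
  finally obtain a where a: "a \<in> carrier (H (susp_ob T 1 A))" "hm w a = hm c y"
    using exact[OF tri' cy] by blast
  then obtain \<alpha> where \<alpha>: "\<alpha> \<in> Arr T (susp_ob T 1 A) Y" "hm \<alpha> y = a"
    using epiA unfolding epi_at_def by blast
  have \<alpha>w: "\<alpha> \<cdot> w \<in> Arr T C Y"
    using comp_closed[of C "susp_ob T 1 A" Y \<alpha> w] o m X \<alpha> by simp
  let ?d = "c \<otimes>\<^bsub>Hom T C Y\<^esub> inv\<^bsub>Hom T C Y\<^esub> (\<alpha> \<cdot> w)"
  have "hm (\<alpha> \<cdot> w) y = hm c y"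
    using map_comp[of C "susp_ob T 1 A" Y \<alpha> w y] o m X \<alpha> a by simp
  then have "hm ?d y = \<one>\<^bsub>H C\<^esub>"
    using group_hom.hom_diff_one_iff[OF eval_group_hom[of C Y y]] o X c \<alpha>w by simp
  then have "\<phi> \<cdot> ?d = \<one>\<^bsub>Hom T C Z\<^esub>"
    using killsC diff_closed[of C Y c "\<alpha> \<cdot> w"] o X c \<alpha>w unfolding kills_def by blast
  then have "\<phi> \<cdot> c = \<phi> \<cdot> \<alpha> \<cdot> w"
    using group_hom.hom_diff_one_iff[OF post_comp_group_hom[of C Y Z \<phi>]] o X \<phi> c \<alpha>w by simp
  moreover have "(\<phi> \<cdot> \<tau>) \<cdot> b = (\<phi> \<cdot> c) \<cdot> v"
    using comp_assoc[of B X Y Z \<phi> \<tau> b] comp_assoc[of B C Y Z \<phi> c v] o m X \<phi> \<tau> b c by simp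
  moreover have "(\<phi> \<cdot> \<alpha> \<cdot> w) \<cdot> v = \<phi> \<cdot> \<alpha> \<cdot> w \<cdot> v"
    using comp_assoc[of B C Y Z \<phi> "\<alpha> \<cdot> w" v] comp_assoc[of B C "susp_ob T 1 A" Y \<alpha> w v]
      o m X \<phi> \<alpha> \<alpha>w by simp
  moreover have "\<phi> \<cdot> \<alpha> \<cdot> w \<cdot> v = \<one>\<^bsub>Hom T B Z\<^esub>"
    using exact_tri_comp_zero[OF tri'] comp_zero_right[of B "susp_ob T 1 A" Y \<alpha>]
      comp_zero_right[of B Y Z \<phi>] o X \<phi> \<alpha> by simp
  ultimately show "(\<phi> \<cdot> \<tau>) \<cdot> b = \<one>\<^bsub>Hom T B Z\<^esub>"
    by simp
qed

section \<open>Sequences of objects and induction over \<open>thick\<close>\<close>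

lemma chain_closed_map:
  assumes "\<And>i. X i \<in> Ob T" "\<And>i. x i \<in> carrier (H (X i))"
    and "\<And>i. \<phi> i \<in> Arr T (X i) (X (Suc i))" "\<And>i. hm (\<phi> i) (x (Suc i)) = x i"
  shows "chain T X \<phi> i n \<in> Arr T (X i) (X (i + n)) \<and> hm (chain T X \<phi> i n) (x (i + n)) = x i"
proof (induction n)
  case 0
  then show ?case using assms id_closed map_id by simp
next
  case (Suc n)
  then show ?case
    using assms(1,2) assms(3,4)[of "i + n"]
      comp_closed[of "X i" "X (i + n)" "X (Suc (i + n))" "\<phi> (i + n)" "chain T X \<phi> i n"]
      map_comp[of "X i" "X (i + n)" "X (Suc (i + n))" "\<phi> (i + n)" "chain T X \<phi> i n"]
    by simp
qed

text \<open>Surjectivity on an extension at stage \<open>i\<close> uses surjectivity on its first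
  part at stage \<open>i - 1\<close>, whence the bound \<open>n \<le> i\<close>. Killing the kernel
  costs one more transition map per extension.\<close>

lemma thick_epi_at_kills:
  assumes G: "G \<in> Ob T"
    and X: "\<And>i. X i \<in> Ob T" "\<And>i. x i \<in> carrier (H (X i))"
    and \<phi>: "\<And>i. \<phi> i \<in> Arr T (X i) (X (Suc i))" "\<And>i. hm (\<phi> i) (x (Suc i)) = x i"
    and epi: "\<And>i m. epi_at (X i) (x i) (susp_ob T m G)"
    and kills: "\<And>i m. kills (X i) (x i) (X (Suc i)) (\<phi> i) (susp_ob T m G)"
  shows "Z \<in> thick T n G \<Longrightarrow> n \<le> i \<Longrightarrow> epi_at (X i) (x i) (susp_ob T m Z) \<and>
    kills (X i) (x i) (X (i + n)) (chain T X \<phi> i n) (susp_ob T m Z)"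
proof (induction n arbitrary: Z i m)
  case 0
  then show ?case by simp
next
  case (Suc n)
  note one_epi = thick1_epi_at[OF _ G X epi]
  note one_kills = thick1_kills[OF _ G X(1) X(1) X(2) \<phi>(1) kills]
  show ?case
  \<comment> \<open>As \<open>thick\<close> starts at 1, the true base case is \<open>Suc 0\<close>,
    where the chain is one transition map after an identity.\<close>
  proof (cases n)
    case 0
    then have "Z \<in> thick1 T G"
      using Suc.prems by simp
    then show ?thesis
      using one_epi[of Z i m] one_kills[of Z i m] 0 id_right[OF X(1) X(1) \<phi>(1)] by simp
  next
    case (Suc k)
    then obtain Z' C a b A B u v w where Z: "Z \<in> Ob T" "Z' \<in> Ob T"
      and cop: "is_coproduct T Z Z' C a b" and tri: "exact_tri T A C B u v w"
      and A: "A \<in> thick T n G" and B: "B \<in> thick1 T G"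
      using Suc.prems(1) by auto
    have C: "C \<in> Ob T" "a \<in> Arr T Z C"
      using cop unfolding is_coproduct_def by auto
    obtain p where p: "p \<in> Arr T C Z" "p \<cdot> a = Id T Z"
      using coproduct_biproduct[OF Z cop] by blast
    obtain u' v' w' where
      tri': "exact_tri T (susp_ob T m A) (susp_ob T m C) (susp_ob T m B) u' v' w'"
      using exact_tri_susp[OF tri] by blast
    have AB: "A \<in> Ob T" "B \<in> Ob T"
      using tri_closed[OF tri] by auto
    obtain j where j: "i = Suc j" "n \<le> j"
      using Suc.prems(2) by (metis Suc_le_D Suc_le_mono)
    \<comment> \<open>The chases also need the desuspended third and the suspended first vertex;
      both are covered because the claims hold for every \<open>m\<close>.\<close>
    have SB: "susp_ob T (-1) (susp_ob T m B) = susp_ob T (-1 + m) B"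
      and SA: "susp_ob T 1 (susp_ob T m A) = susp_ob T (1 + m) A"
      using susp_ob_add[OF AB(2), of "-1" m] susp_ob_add[OF AB(1), of 1 m] by simp_all
    have chain: "chain T X \<phi> i n \<in> Arr T (X i) (X (i + n))"
      "hm (chain T X \<phi> i n) (x (i + n)) = x i"
      using chain_closed_map[where X = X and x = x and \<phi> = \<phi>, OF X \<phi>] by blast+
    have "epi_at (X i) (x i) (susp_ob T m C)"
      unfolding j(1)
    proof (rule epi_at_triangle[OF tri' X(1) X(1) X(2) X(2) \<phi>])
      show "epi_at (X j) (x j) (susp_ob T m A)"
        using Suc.IH[OF A j(2)] by blast
    qed (use SB one_kills[OF B] one_epi[OF B] in simp_all)
    moreover have "kills (X i) (x i) (X (Suc (i + n))) (\<phi> (i + n) \<cdot> chain T X \<phi> i n) (susp_ob T m C)"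
    proof (rule kills_triangle[OF tri' X(1) X(1) X(1) X(2) X(2) chain \<phi>(1)])
      show "kills (X i) (x i) (X (i + n)) (chain T X \<phi> i n) (susp_ob T m A)"
        using Suc.IH[OF A] Suc.prems(2) by simp
      show "epi_at (X (i + n)) (x (i + n)) (susp_ob T 1 (susp_ob T m A))"
        using Suc.IH[OF A] Suc.prems(2) SA by simp
    qed (use one_kills[OF B] in simp)
    moreover have "\<phi> (i + n) \<cdot> chain T X \<phi> i n \<in> Arr T (X i) (X (Suc (i + n)))"
      using comp_closed[OF X(1) X(1) X(1) \<phi>(1) chain(1)] by simp
    \<comment> \<open>\<open>Z\<close> is only a summand of the middle term \<open>C\<close>, so
      both properties are carried over to it as to a retract.\<close>
    moreover have "susp T m a \<in> Arr T (susp_ob T m Z) (susp_ob T m C)"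
      "susp T m p \<in> Arr T (susp_ob T m C) (susp_ob T m Z)"
      "susp T m p \<cdot> susp T m a = Id T (susp_ob T m Z)"
      using susp_closed[of Z C a m] susp_closed[of C Z p m] susp_comp[of Z C Z p a m] susp_id[of Z m]
        Z C p by auto
    moreover have "susp_ob T m Z \<in> Ob T" "susp_ob T m C \<in> Ob T"
      using susp_ob_closed Z C by auto
    ultimately show ?thesis
      using epi_at_retract[of "X i" "susp_ob T m Z" "susp_ob T m C" "x i" "susp T m a" "susp T m p"]
        kills_retract[of "X i" "X (Suc (i + n))" "susp_ob T m Z" "susp_ob T m C" "x i" _
          "susp T m a" "susp T m p"] X by simp
  qed
qed

text \<open>As \<open>x\<close> is the restriction of \<open>y\<close>, the kernels of
  \<open>x\<close> and of \<open>\<phi>\<close> agree. Lifting \<open>y\<close> along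
  \<open>x\<close> therefore splits the surjection from Hom into \<open>X\<close> onto
  \<open>H\<close>.\<close>

lemma representable_if_killed:
  assumes idem: "idempotent_complete T"
    and X: "X \<in> Ob T" "Y \<in> Ob T" "x \<in> carrier (H X)" "y \<in> carrier (H Y)"
    and \<phi>: "\<phi> \<in> Arr T X Y" "hm \<phi> y = x"
    and epi: "\<And>V. V \<in> Ob T \<Longrightarrow> epi_at X x V"
    and kills: "\<And>V. V \<in> Ob T \<Longrightarrow> kills X x Y \<phi> V"
  shows "\<exists>P\<in>Ob T. \<exists>z\<in>carrier (H P). \<forall>V\<in>Ob T. bij_betw (\<lambda>h. hm h z) (Arr T V P) (carrier (H V))"
proof -
  obtain \<psi> where \<psi>: "\<psi> \<in> Arr T Y X" "hm \<psi> x = y"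
    using epi[OF X(2)] X unfolding epi_at_def by blast
  define e where "e = \<psi> \<cdot> \<phi>"
  have e: "e \<in> Arr T X X"
    unfolding e_def using comp_closed[of X Y X \<psi> \<phi>] X \<phi> \<psi> by simp
  have ex: "hm e x = x"
    unfolding e_def using map_comp[of X Y X \<psi> \<phi> x] X \<phi> \<psi> by simp
  let ?d = "e \<otimes>\<^bsub>Hom T X X\<^esub> inv\<^bsub>Hom T X X\<^esub> Id T X"
  \<comment> \<open>Both \<open>e\<close> and the identity fix \<open>x\<close>, so
    \<open>\<phi>\<close> kills their difference; this gives
    \<open>\<phi> \<cdot> e = \<phi>\<close> and makes \<open>e\<close> idempotent.\<close>
  have "hm ?d x = \<one>\<^bsub>H X\<^esub>"
    using group_hom.hom_diff_one_iff[OF eval_group_hom[of X X x] e id_closed[of X]] ex map_id[of X x] X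
    by simp
  then have "\<phi> \<cdot> ?d = \<one>\<^bsub>Hom T X Y\<^esub>"
    using kills[OF X(1)] diff_closed[of X X e "Id T X"] id_closed[of X] X e unfolding kills_def by blast
  then have "\<phi> \<cdot> e = \<phi>"
    using group_hom.hom_diff_one_iff[OF post_comp_group_hom[of X X Y \<phi>] e id_closed[of X]]
      id_right[of X Y \<phi>] X \<phi> by simp
  then have "e \<cdot> e = e"
    unfolding e_def using comp_assoc[of X X Y X \<psi> \<phi> "\<psi> \<cdot> \<phi>"] e X \<phi> \<psi> by (simp add: e_def)
  then obtain P p \<iota> where P: "P \<in> Ob T" "p \<in> Arr T X P" "\<iota> \<in> Arr T P X" "\<iota> \<cdot> p = e" "p \<cdot> \<iota> = Id T P"
    using idem X e unfolding idempotent_complete_def by blast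
  define z where "z = hm \<iota> x"
  have z: "z \<in> carrier (H P)"
    unfolding z_def using map_closed[of P X \<iota> x] P X by simp
  have "bij_betw (\<lambda>h. hm h z) (Arr T V P) (carrier (H V))" if V: "V \<in> Ob T" for V
  proof -
    interpret ev: group_hom "Hom T V P" "H V" "\<lambda>h. hm h z"
      using eval_group_hom V P z by blast
    have "\<exists>h\<in>Arr T V P. hm h z = t" if t: "t \<in> carrier (H V)" for t
    proof -
      obtain h where h: "h \<in> Arr T V X" "hm h x = t"
        using epi[OF V] t unfolding epi_at_def by blast
      have "hm (p \<cdot> h) z = hm h (hm (\<iota> \<cdot> p) x)"
        unfolding z_def using map_comp[of V X P p h "hm \<iota> x"] map_comp[of X P X \<iota> p x] z z_def V X P h
        by simp
      then have "hm (p \<cdot> h) z = t"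
        using P ex h by simp
      then show ?thesis
        using comp_closed[of V X P p h] V X P h by blast
    qed
    moreover have "h = \<one>\<^bsub>Hom T V P\<^esub>" if h: "h \<in> Arr T V P" "hm h z = \<one>\<^bsub>H V\<^esub>" for h
    proof -
      have \<iota>h: "\<iota> \<cdot> h \<in> Arr T V X"
        using comp_closed[of V P X \<iota> h] V X P h by simp
      have "hm (\<iota> \<cdot> h) x = \<one>\<^bsub>H V\<^esub>"
        using map_comp[of V P X \<iota> h x] V X P h z_def by simp
      then have "\<phi> \<cdot> \<iota> \<cdot> h = \<one>\<^bsub>Hom T V Y\<^esub>"
        using kills[OF V] \<iota>h unfolding kills_def by blast
      then have "e \<cdot> \<iota> \<cdot> h = \<one>\<^bsub>Hom T V X\<^esub>"
        unfolding e_def using comp_assoc[of V X Y X \<psi> \<phi> "\<iota> \<cdot> h"] comp_zero_right[of V Y X \<psi>] V X \<phi> \<psi> \<iota>h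
        by simp
      \<comment> \<open>Both copies of \<open>p \<cdot> \<iota>\<close> are identities, so
        \<open>p \<cdot> e\<close> recovers \<open>h\<close> from
        \<open>\<iota> \<cdot> h\<close>.\<close>
      moreover have "p \<cdot> e \<cdot> \<iota> \<cdot> h = (p \<cdot> \<iota>) \<cdot> (p \<cdot> \<iota>) \<cdot> h"
        using comp_assoc[of V X P X \<iota> p "\<iota> \<cdot> h"] comp_assoc[of V P X P p \<iota> h]
          comp_assoc[of V P X P p \<iota> "p \<cdot> \<iota> \<cdot> h"] comp_closed[of V X P p "\<iota> \<cdot> h"] V X P h \<iota>h by simp
      moreover have "(p \<cdot> \<iota>) \<cdot> (p \<cdot> \<iota>) \<cdot> h = h"
        using id_left[of V P h] V P h by simp
      ultimately show ?thesis
        using comp_zero_right[of V X P p] V X P by simp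
    qed
    ultimately show ?thesis
      unfolding bij_betw_def ev.inj_on_one_iff by (auto simp: image_iff intro: ev.hom_closed)
  qed
  then show ?thesis
    using P z by blast
qed

text \<open>\<open>fg\<close> and \<open>fp\<close> are the finiteness conditions seen in degree
  zero: all degrees at \<open>V\<close> have become all suspensions of \<open>V\<close>, with one
  \<open>X\<close> or one \<open>W\<close> serving them together.\<close>

theorem representable:
  assumes idem: "idempotent_complete T" and gen: "strongly_generated T"
    and fg: "\<And>V. V \<in> Ob T \<Longrightarrow>
      \<exists>X\<in>Ob T. \<exists>x\<in>carrier (H X). \<forall>m. epi_at X x (susp_ob T m V)"
    and fp: "\<And>V X x. \<lbrakk>V \<in> Ob T; X \<in> Ob T; x \<in> carrier (H X)\<rbrakk> \<Longrightarrow>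
      \<exists>W\<in>Ob T. \<exists>k\<in>Arr T W X. hm k x = \<one>\<^bsub>H W\<^esub> \<and>
        (\<forall>m. \<forall>h\<in>Arr T (susp_ob T m V) X. hm h x = \<one>\<^bsub>H (susp_ob T m V)\<^esub> \<longrightarrow>
          (\<exists>g\<in>Arr T (susp_ob T m V) W. h = k \<cdot> g))"
  shows "\<exists>P\<in>Ob T. \<exists>z\<in>carrier (H P). \<forall>V\<in>Ob T. bij_betw (\<lambda>h. hm h z) (Arr T V P) (carrier (H V))"
proof -
  obtain G n where G: "G \<in> Ob T" and n: "thick T n G = Ob T"
    using gen unfolding strongly_generated_def by blast
  have step: "\<exists>Y\<in>Ob T. \<exists>y\<in>carrier (H Y). \<exists>\<phi>\<in>Arr T X Y. hm \<phi> y = x \<and>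
      (\<forall>m. kills X x Y \<phi> (susp_ob T m G))" if X: "X \<in> Ob T" "x \<in> carrier (H X)" for X x
  proof -
    obtain W k where W: "W \<in> Ob T" "k \<in> Arr T W X" "hm k x = \<one>\<^bsub>H W\<^esub>"
      and k: "\<And>m h. \<lbrakk>h \<in> Arr T (susp_ob T m G) X; hm h x = \<one>\<^bsub>H (susp_ob T m G)\<^esub>\<rbrakk> \<Longrightarrow>
        \<exists>g\<in>Arr T (susp_ob T m G) W. h = k \<cdot> g"
      using fp[OF G X] by blast
    \<comment> \<open>The cone of a map that covers the kernel kills it, and \<open>x\<close>
      extends to the cone because it vanishes on \<open>W\<close>.\<close>
    obtain Y v w where tri: "exact_tri T W X Y k v w"
      using TR1_cone[OF W(1) X(1) W(2)] by blast
    have Y: "Y \<in> Ob T" "v \<in> Arr T X Y"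
      using tri_closed[OF tri] by auto
    obtain y where y: "y \<in> carrier (H Y)" "hm v y = x"
      using exact[OF tri X(2) W(3)] by blast
    have "kills X x Y v (susp_ob T m G)" for m
      unfolding kills_def
    proof (intro ballI impI)
      fix h assume "h \<in> Arr T (susp_ob T m G) X" "hm h x = \<one>\<^bsub>H (susp_ob T m G)\<^esub>"
      then obtain g where g: "g \<in> Arr T (susp_ob T m G) W" "h = k \<cdot> g"
        using k by blast
      then have "v \<cdot> h = (v \<cdot> k) \<cdot> g"
        using comp_assoc[of "susp_ob T m G" W X Y v k g] susp_ob_closed[OF G] W X Y by simp
      then show "v \<cdot> h = \<one>\<^bsub>Hom T (susp_ob T m G) Y\<^esub>"
        using exact_tri_comp_zero[OF tri] comp_zero_left[of "susp_ob T m G" W Y g]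
          susp_ob_closed[OF G] W Y g by simp
    qed
    then show ?thesis
      using Y y by blast
  qed
  \<comment> \<open>Dependent choice runs over pairs of an object and an element: \<open>S\<close>
    is the invariant and \<open>Q\<close> the transition.\<close>
  define S where "S p \<longleftrightarrow> fst p \<in> Ob T \<and> snd p \<in> carrier (H (fst p)) \<and>
    (\<forall>m. epi_at (fst p) (snd p) (susp_ob T m G))" for p
  define Q where "Q p q \<longleftrightarrow> (\<exists>\<phi>\<in>Arr T (fst p) (fst q). hm \<phi> (snd q) = snd p \<and>
    (\<forall>m. kills (fst p) (snd p) (fst q) \<phi> (susp_ob T m G)))" for p q
  have "\<exists>s. \<forall>i. S (s i) \<and> Q (s i) (s (Suc i))"
  proof (rule dependent_nat_choice)
    show "\<exists>p. S p"
      using fg[OF G] unfolding S_def by auto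
  next
    fix p and i :: nat assume "S p"
    then have p: "fst p \<in> Ob T" "snd p \<in> carrier (H (fst p))"
      and epi: "\<And>m. epi_at (fst p) (snd p) (susp_ob T m G)"
      unfolding S_def by auto
    obtain Y y \<phi> where Y: "Y \<in> Ob T" "y \<in> carrier (H Y)" "\<phi> \<in> Arr T (fst p) Y" "hm \<phi> y = snd p"
      and kills: "\<And>m. kills (fst p) (snd p) Y \<phi> (susp_ob T m G)"
      using step[OF p] by blast
    have "epi_at Y y (susp_ob T m G)" for m
      unfolding epi_at_def
    proof
      fix z assume "z \<in> carrier (H (susp_ob T m G))"
      then obtain h where h: "h \<in> Arr T (susp_ob T m G) (fst p)" "hm h (snd p) = z"
        using epi unfolding epi_at_def by blast
      then have "\<phi> \<cdot> h \<in> Arr T (susp_ob T m G) Y" "hm (\<phi> \<cdot> h) y = z"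
        using comp_closed[of "susp_ob T m G" "fst p" Y \<phi> h] p Y susp_ob_closed[OF G]
          map_comp[of "susp_ob T m G" "fst p" Y \<phi> h y] by auto
      then show "\<exists>h\<in>Arr T (susp_ob T m G) Y. hm h y = z"
        by blast
    qed
    then show "\<exists>q. S q \<and> Q p q"
      using Y kills unfolding S_def Q_def by (intro exI[of _ "(Y, y)"]) auto
  qed
  then obtain s where s: "\<And>i. S (s i)" "\<And>i. Q (s i) (s (Suc i))"
    by blast
  define X where "X i = fst (s i)" for i
  define x where "x i = snd (s i)" for i
  have X: "\<And>i. X i \<in> Ob T" "\<And>i. x i \<in> carrier (H (X i))"
    and epi: "\<And>i m. epi_at (X i) (x i) (susp_ob T m G)"
    using s(1) unfolding S_def X_def x_def by auto
  have "\<forall>i. \<exists>\<phi>. \<phi> \<in> Arr T (X i) (X (Suc i)) \<and> hm \<phi> (x (Suc i)) = x i \<and>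
      (\<forall>m. kills (X i) (x i) (X (Suc i)) \<phi> (susp_ob T m G))"
    using s(2) unfolding Q_def X_def x_def by blast
  then obtain \<phi> where \<phi>: "\<And>i. \<phi> i \<in> Arr T (X i) (X (Suc i))" "\<And>i. hm (\<phi> i) (x (Suc i)) = x i"
    and kills: "\<And>i m. kills (X i) (x i) (X (Suc i)) (\<phi> i) (susp_ob T m G)"
    by metis
  have chain: "chain T X \<phi> n n \<in> Arr T (X n) (X (n + n))"
    "hm (chain T X \<phi> n n) (x (n + n)) = x n"
    using chain_closed_map[where X = X and x = x and \<phi> = \<phi>, OF X \<phi>] by blast+
  \<comment> \<open>Starting at stage \<open>n\<close> meets the bound of the induction, and
    \<open>V\<close> is its own zeroth suspension.\<close>
  have all: "epi_at (X n) (x n) V \<and> kills (X n) (x n) (X (n + n)) (chain T X \<phi> n n) V"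
    if "V \<in> Ob T" for V
    using thick_epi_at_kills[where X = X and x = x and \<phi> = \<phi>, OF G X \<phi> epi kills, of V n n 0] n that susp_ob_zero[OF that] by simp
  show ?thesis
    using representable_if_killed[OF idem X(1) X(1) X(2) X(2) chain] all by blast
qed

end

section \<open>Graded functors and their degree zero part\<close>

lemma Ext_functor_simps [simp]:
  "fun_ob (Ext_functor T \<phi> X) Y = Ext T \<phi> Y X"
  "fun_map (Ext_functor T \<phi> X) h d k = k \<cdot>\<^bsub>T\<^esub> h"
  "fun_shift (Ext_functor T \<phi> X) n Y d k = susp T n k"
  "deg (Ext T \<phi> Y X) d = Hom T Y (susp_ob T d X)"
  "act (Ext T \<phi> Y X) a d r k = \<phi> a r (susp_ob T d X) \<cdot>\<^bsub>T\<^esub> k"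
  by (simp_all add: Ext_functor_def Ext_def)

lemma kernel_functor_simps [simp]:
  "fun_map (kernel_functor F F' \<zeta>) = fun_map F"
  "fun_shift (kernel_functor F F' \<zeta>) = fun_shift F"
  "carrier (deg (fun_ob (kernel_functor F F' \<zeta>) X) d)
    = kernel (deg (fun_ob F X) d) (deg (fun_ob F' X) d) (\<zeta> X d)"
  by (simp_all add: kernel_functor_def)

section \<open>Transformations out of \<open>Ext_functor\<close>\<close>

context triangulated_category
begin

text \<open>The Yoneda argument; the identity has degree zero because the zeroth suspension of
  \<open>Y\<close> is \<open>Y\<close>. \<open>F'\<close> is an arbitrary record so that kernel
  functors are covered.\<close>

lemma Ext_transformation_at_id:
  assumes nat: "natural_transformation A T (Ext_functor T \<phi> Y) F' \<zeta>" and Y: "Y \<in> Ob T"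
  shows "\<zeta> Y 0 (Id T Y) \<in> carrier (deg (fun_ob F' Y) 0)"
    and "\<lbrakk>X \<in> Ob T; h \<in> Arr T X Y\<rbrakk> \<Longrightarrow> \<zeta> X 0 h = fun_map F' h 0 (\<zeta> Y 0 (Id T Y))"
proof -
  have id: "Id T Y \<in> carrier (deg (fun_ob (Ext_functor T \<phi> Y) Y) 0)"
    using id_closed Y susp_ob_zero by simp
  have "\<zeta> Y 0 \<in> hom (deg (fun_ob (Ext_functor T \<phi> Y) Y) 0) (deg (fun_ob F' Y) 0)"
    using nat Y unfolding natural_transformation_def gmod_hom_def by blast
  then show "\<zeta> Y 0 (Id T Y) \<in> carrier (deg (fun_ob F' Y) 0)"
    using id hom_in_carrier by metis
  assume "X \<in> Ob T" "h \<in> Arr T X Y"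
  moreover from this have
    "\<zeta> X 0 (fun_map (Ext_functor T \<phi> Y) h 0 (Id T Y)) = fun_map F' h 0 (\<zeta> Y 0 (Id T Y))"
    using nat Y id unfolding natural_transformation_def by blast
  ultimately show "\<zeta> X 0 h = fun_map F' h 0 (\<zeta> Y 0 (Id T Y))"
    using id_left[of X Y h] Y by simp
qed

text \<open>Degree \<open>- m\<close> at \<open>X\<close> corresponds to degree zero at
  \<open>susp_ob T m X\<close>, so surjectivity at \<open>X\<close> in that degree moves to the
  suspension.\<close>

lemma Ext_transformation_surj_susp:
  assumes nat: "natural_transformation A T (Ext_functor T \<phi> Y) F' \<zeta>"
    and o: "X \<in> Ob T" "Y \<in> Ob T"
    and surj: "\<zeta> X (- m) ` carrier (deg (fun_ob (Ext_functor T \<phi> Y) X) (- m))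
      = carrier (deg (fun_ob F' X) (- m))"
    and z: "z \<in> carrier (deg (fun_ob F' X) (- m))"
  shows "\<exists>h\<in>Arr T (susp_ob T m X) Y. fun_map F' h 0 (\<zeta> Y 0 (Id T Y)) = fun_shift F' m X 0 z"
proof -
  have "z \<in> \<zeta> X (- m) ` Arr T X (susp_ob T (- m) Y)"
    using surj z by simp
  then obtain k where k: "k \<in> Arr T X (susp_ob T (- m) Y)" "\<zeta> X (- m) k = z"
    by blast
  have sk: "susp T m k \<in> Arr T (susp_ob T m X) Y"
    using susp_closed[of X "susp_ob T (- m) Y" k m] k o susp_ob_closed susp_ob_cancel by simp
  have "k \<in> carrier (deg (fun_ob (Ext_functor T \<phi> Y) X) (- m + 0))"
    using k by simp
  then have "\<zeta> (susp_ob T m X) 0 (fun_shift (Ext_functor T \<phi> Y) m X 0 k)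
      = fun_shift F' m X 0 (\<zeta> X (- m + 0) k)"
    using nat o unfolding natural_transformation_def by blast
  then have "\<zeta> (susp_ob T m X) 0 (susp T m k) = fun_shift F' m X 0 z"
    using k by simp
  then show ?thesis
    using Ext_transformation_at_id(2)[OF nat o(2) _ sk] susp_ob_closed o sk by auto
qed

end

section \<open>The degree zero part of a graded functor and the way back\<close>

context graded_linear_functor
begin

lemma group_deg: "X \<in> Ob T \<Longrightarrow> group (deg (fun_ob F X) d)"
  using graded_module.deg_group[OF ob_module] comm_group.axioms(2) by blast

lemma fun_map_hom:
  "\<lbrakk>X \<in> Ob T; Y \<in> Ob T; h \<in> Arr T X Y\<rbrakk> \<Longrightarrow> fun_map F h d \<in> hom (deg (fun_ob F Y) d) (deg (fun_ob F X) d)"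
  using map_hom unfolding gmod_hom_def by blast

lemma shift_bij_betw:
  "X \<in> Ob T \<Longrightarrow> bij_betw (fun_shift F n X d) (carrier (deg (fun_ob F X) (- n + d)))
    (carrier (deg (fun_ob F (susp_ob T n X)) d))"
  using shift_iso[of X n] unfolding gmod_iso_def gmod_shift_def by simp

lemma shift_group_hom:
  assumes "X \<in> Ob T"
  shows "group_hom (deg (fun_ob F X) (- n + d)) (deg (fun_ob F (susp_ob T n X)) d) (fun_shift F n X d)"
  unfolding group_hom_def group_hom_axioms_def
  using shift_iso[OF assms, of n] group_deg[OF assms, of "- n + d"]
    group_deg[OF susp_ob_closed[OF assms], of n d]
  unfolding gmod_iso_def gmod_hom_def gmod_shift_def by simp

lemma shift_closed:
  "\<lbrakk>X \<in> Ob T; x \<in> carrier (deg (fun_ob F X) (- n + d))\<rbrakk>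
    \<Longrightarrow> fun_shift F n X d x \<in> carrier (deg (fun_ob F (susp_ob T n X)) d)"
  using group_hom.hom_closed[OF shift_group_hom] .

text \<open>By \<open>shift_add\<close> this map is idempotent, and an injective idempotent is the
  identity.\<close>

lemma shift_zero:
  assumes X: "X \<in> Ob T" and x: "x \<in> carrier (deg (fun_ob F X) d)"
  shows "fun_shift F 0 X d x = x"
proof -
  have s: "fun_shift F 0 X d x \<in> carrier (deg (fun_ob F X) d)"
    using shift_closed[OF X, of x 0 d] x susp_ob_zero[OF X] by simp
  have "fun_shift F 0 X d (fun_shift F 0 X d x) = fun_shift F 0 X d x"
    using shift_add[OF X, of x 0 0 d] x susp_ob_zero[OF X] by simp
  moreover have "inj_on (fun_shift F 0 X d) (carrier (deg (fun_ob F X) d))"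
    using shift_bij_betw[OF X, of 0 d] unfolding bij_betw_def by simp
  ultimately show ?thesis
    using s x unfolding inj_on_def by blast
qed

lemma degree_map_zero:
  "\<lbrakk>Y \<in> Ob T; x \<in> carrier (deg (fun_ob F Y) e)\<rbrakk> \<Longrightarrow> degree_map F 0 Y h e x = fun_map F h e x"
  unfolding degree_map_def using shift_zero by simp

lemma degree_map_closed:
  assumes "X \<in> Ob T" "Y \<in> Ob T" "h \<in> Arr T X (susp_ob T d Y)" "x \<in> carrier (deg (fun_ob F Y) e)"
  shows "degree_map F d Y h e x \<in> carrier (deg (fun_ob F X) (d + e))"
proof -
  have "fun_shift F d Y (d + e) x \<in> carrier (deg (fun_ob F (susp_ob T d Y)) (d + e))"
    using shift_closed[of Y x d "d + e"] assms by simp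
  then show ?thesis
    unfolding degree_map_def
    using hom_in_carrier[OF fun_map_hom] assms susp_ob_closed by blast
qed

text \<open>Additivity is \<open>degree_map_add\<close> in degree zero, and exactness is the long
  exact sequence at \<open>n = 0\<close>.\<close>

lemma cohomological_functor_degree_zero:
  assumes "cohomological T F"
  shows "cohomological_functor T (\<lambda>X. deg (fun_ob F X) 0) (\<lambda>h. fun_map F h 0)"
proof (rule cohomological_functor.intro[OF triangulated_category_axioms cohomological_functor_axioms.intro])
  fix X assume "X \<in> Ob T"
  then show "group (deg (fun_ob F X) 0)"
    by (rule group_deg)
next
  fix X Y h assume "X \<in> Ob T" "Y \<in> Ob T" "h \<in> Arr T X Y"
  then show "fun_map F h 0 \<in> hom (deg (fun_ob F Y) 0) (deg (fun_ob F X) 0)"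
    by (rule fun_map_hom)
next
  fix X x assume "X \<in> Ob T" "x \<in> carrier (deg (fun_ob F X) 0)"
  then show "fun_map F (Id T X) 0 x = x"
    by (rule map_id)
next
  fix X Y Z g h x
  assume "X \<in> Ob T" "Y \<in> Ob T" "Z \<in> Ob T" "g \<in> Arr T Y Z" "h \<in> Arr T X Y"
    "x \<in> carrier (deg (fun_ob F Z) 0)"
  then show "fun_map F (g \<cdot>\<^bsub>T\<^esub> h) 0 x = fun_map F h 0 (fun_map F g 0 x)"
    by (rule map_comp)
next
  fix X Y h h' x
  assume "X \<in> Ob T" "Y \<in> Ob T" "h \<in> Arr T X Y" "h' \<in> Arr T X Y" "x \<in> carrier (deg (fun_ob F Y) 0)"
  then show "fun_map F (h \<otimes>\<^bsub>Hom T X Y\<^esub> h') 0 x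
      = fun_map F h 0 x \<otimes>\<^bsub>deg (fun_ob F X) 0\<^esub> fun_map F h' 0 x"
    using degree_map_add[of X Y h 0 h' x 0] degree_map_zero[of Y x 0] susp_ob_zero[of Y] by simp
next
  fix X Y Z u v w y
  assume tri: "exact_tri T X Y Z u v w" and y: "y \<in> carrier (deg (fun_ob F Y) 0)"
    "fun_map F u 0 y = \<one>\<^bsub>deg (fun_ob F X) 0\<^esub>"
  have o: "X \<in> Ob T" "Y \<in> Ob T" "Z \<in> Ob T" and m: "u \<in> Arr T X Y" "v \<in> Arr T Y Z"
    using tri_closed[OF tri] by auto
  have "gmod_exact (fun_ob F (susp_ob T 0 Z)) (fun_map F (susp T 0 v)) (fun_ob F (susp_ob T 0 Y))
      (fun_map F (susp T 0 u)) (fun_ob F (susp_ob T 0 X))"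
    using assms tri unfolding cohomological_def Let_def by blast
  then have "fun_map F v 0 ` carrier (deg (fun_ob F Z) 0)
      = kernel (deg (fun_ob F Y) 0) (deg (fun_ob F X) 0) (fun_map F u 0)"
    using o m susp_ob_zero susp_zero[OF o(1,2) m(1)] susp_zero[OF o(2,3) m(2)]
    unfolding gmod_exact_def by simp
  then have "y \<in> fun_map F v 0 ` carrier (deg (fun_ob F Z) 0)"
    using y unfolding kernel_def by simp
  then show "\<exists>z\<in>carrier (deg (fun_ob F Z) 0). fun_map F v 0 z = y"
    by blast
qed

text \<open>Graded Yoneda: \<open>x\<close> is carried to the \<open>d\<close>-fold suspension of
  \<open>X\<close> and pulled back along \<open>h\<close>. Linearity over the ring comes from
  \<open>degree_map_act\<close>.\<close>

lemma yoneda_natural_transformation: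
  assumes X: "X \<in> Ob T" and x: "x \<in> carrier (deg (fun_ob F X) 0)"
  shows "natural_transformation A T (Ext_functor T \<phi> X) F (\<lambda>Y d h. degree_map F d X h 0 x)"
  unfolding natural_transformation_def
proof (intro conjI ballI allI)
  fix Y assume Y: "Y \<in> Ob T"
  show "gmod_hom A (fun_ob (Ext_functor T \<phi> X) Y) (fun_ob F Y) (\<lambda>d h. degree_map F d X h 0 x)"
    unfolding gmod_hom_def
  proof (intro conjI allI ballI)
    fix d
    show "(\<lambda>h. degree_map F d X h 0 x) \<in> hom (deg (fun_ob (Ext_functor T \<phi> X) Y) d) (deg (fun_ob F Y) d)"
      unfolding hom_def
      using degree_map_closed[of Y X _ d x 0] degree_map_add[of Y X _ d _ x 0] X Y x by auto
  next
    fix a e r h assume "r \<in> A a" "h \<in> carrier (deg (fun_ob (Ext_functor T \<phi> X) Y) e)"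
    then show "degree_map F (a + e) X (act (fun_ob (Ext_functor T \<phi> X) Y) a e r h) 0 x
        = act (fun_ob F Y) a e r (degree_map F e X h 0 x)"
      using degree_map_act[of Y X h e r a x 0] X Y x by simp
  qed
next
  fix Y Z h d k
  assume "Y \<in> Ob T" "Z \<in> Ob T" "h \<in> Arr T Y Z" "k \<in> carrier (deg (fun_ob (Ext_functor T \<phi> X) Z) d)"
  then show "degree_map F d X (fun_map (Ext_functor T \<phi> X) h d k) 0 x
      = fun_map F h d (degree_map F d X k 0 x)"
    using map_comp[of Y Z "susp_ob T d X" k h "fun_shift F d X d x" d]
      shift_closed[of X x d d] susp_ob_closed X x
    unfolding degree_map_def by simp
next
  fix Y n d k assume Y: "Y \<in> Ob T" and "k \<in> carrier (deg (fun_ob (Ext_functor T \<phi> X) Y) (- n + d))"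
  then have k: "k \<in> Arr T Y (susp_ob T (- n + d) X)"
    by simp
  let ?y = "fun_shift F (- n + d) X (- n + d) x"
  have y: "?y \<in> carrier (deg (fun_ob F (susp_ob T (- n + d) X)) (- n + d))"
    using shift_closed[of X x "- n + d" "- n + d"] X x by simp
  \<comment> \<open>The \<open>d\<close>-fold suspension is reached in two stages; naturality then
    moves \<open>k\<close> across the outer one.\<close>
  have "fun_shift F d X d x = fun_shift F n (susp_ob T (- n + d) X) d ?y"
    using shift_add[of X x n "- n + d" d] X x by simp
  then show "degree_map F d X (fun_shift (Ext_functor T \<phi> X) n Y d k) 0 x
      = fun_shift F n Y d (degree_map F (- n + d) X k 0 x)"
    using shift_natural[OF Y susp_ob_closed[OF X] k y] unfolding degree_map_def by simp
qed

text \<open>The dictionary between degree zero at suspensions of \<open>Y\<close> and other degrees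
  at \<open>Y\<close>.\<close>

lemma degree_map_susp:
  assumes "X \<in> Ob T" "Y \<in> Ob T" "x \<in> carrier (deg (fun_ob F X) 0)" "k \<in> Arr T Y (susp_ob T (- n) X)"
  shows "fun_map F (susp T n k) 0 x = fun_shift F n Y 0 (degree_map F (- n) X k 0 x)"
proof -
  have "k \<in> carrier (deg (fun_ob (Ext_functor T \<phi> X) Y) (- n + 0))"
    using assms by simp
  then have "degree_map F 0 X (fun_shift (Ext_functor T \<phi> X) n Y 0 k) 0 x
      = fun_shift F n Y 0 (degree_map F (- n + 0) X k 0 x)"
    using yoneda_natural_transformation[OF assms(1,3)] assms(2)
    unfolding natural_transformation_def by blast
  then show ?thesis
    using degree_map_zero assms by simp
qed

lemma locally_finitely_generated_degree_zero:
  assumes lfg: "locally_finitely_generated A T \<phi> F" and V: "V \<in> Ob T"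
  shows "\<exists>Y\<in>Ob T. \<exists>y\<in>carrier (deg (fun_ob F Y) 0). \<forall>m. \<forall>z\<in>carrier (deg (fun_ob F (susp_ob T m V)) 0).
    \<exists>h\<in>Arr T (susp_ob T m V) Y. fun_map F h 0 y = z"
proof -
  obtain Y \<zeta> where Y: "Y \<in> Ob T" and nat: "natural_transformation A T (Ext_functor T \<phi> Y) F \<zeta>"
    and surj: "\<And>d. \<zeta> V d ` carrier (deg (fun_ob (Ext_functor T \<phi> Y) V) d) = carrier (deg (fun_ob F V) d)"
    using lfg V unfolding locally_finitely_generated_def by blast
  have "\<exists>h\<in>Arr T (susp_ob T m V) Y. fun_map F h 0 (\<zeta> Y 0 (Id T Y)) = z"
    if z: "z \<in> carrier (deg (fun_ob F (susp_ob T m V)) 0)" for m z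
  proof -
    have "z \<in> fun_shift F m V 0 ` carrier (deg (fun_ob F V) (- m))"
      using shift_bij_betw[OF V, of m 0] z unfolding bij_betw_def by simp
    then obtain z' where "z' \<in> carrier (deg (fun_ob F V) (- m))" "fun_shift F m V 0 z' = z"
      by blast
    then show ?thesis
      using Ext_transformation_surj_susp[OF nat V Y surj] by metis
  qed
  then show ?thesis
    using Ext_transformation_at_id(1)[OF nat Y] Y by blast
qed

text \<open>Finite presentation is applied to the Yoneda transformation of \<open>x\<close>. An
  object \<open>W\<close> covering its kernel at \<open>V\<close> yields \<open>k\<close> as the
  image of the identity of \<open>W\<close>.\<close>

lemma locally_finitely_presented_degree_zero:
  assumes lfp: "locally_finitely_presented A T \<phi> F"
    and V: "V \<in> Ob T" and X: "X \<in> Ob T" and x: "x \<in> carrier (deg (fun_ob F X) 0)"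
  shows "\<exists>W\<in>Ob T. \<exists>k\<in>Arr T W X. fun_map F k 0 x = \<one>\<^bsub>deg (fun_ob F W) 0\<^esub> \<and>
    (\<forall>m. \<forall>h\<in>Arr T (susp_ob T m V) X. fun_map F h 0 x = \<one>\<^bsub>deg (fun_ob F (susp_ob T m V)) 0\<^esub> \<longrightarrow>
      (\<exists>g\<in>Arr T (susp_ob T m V) W. h = k \<cdot>\<^bsub>T\<^esub> g))"
proof -
  let ?\<zeta> = "\<lambda>Y d h. degree_map F d X h 0 x"
  let ?K = "kernel_functor (Ext_functor T \<phi> X) F ?\<zeta>"
  have "locally_finitely_generated A T \<phi> ?K"
    using lfp X yoneda_natural_transformation[OF X x] unfolding locally_finitely_presented_def by blast
  then obtain W \<xi> where W: "W \<in> Ob T" and nat: "natural_transformation A T (Ext_functor T \<phi> W) ?K \<xi>"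
    and surj: "\<And>d. \<xi> V d ` carrier (deg (fun_ob (Ext_functor T \<phi> W) V) d) = carrier (deg (fun_ob ?K V) d)"
    using V unfolding locally_finitely_generated_def by blast
  define k where "k = \<xi> W 0 (Id T W)"
  have "k \<in> carrier (deg (fun_ob ?K W) 0)"
    unfolding k_def by (rule Ext_transformation_at_id(1)[OF nat W])
  then have k: "k \<in> Arr T W X" "fun_map F k 0 x = \<one>\<^bsub>deg (fun_ob F W) 0\<^esub>"
    using degree_map_zero[OF X x] susp_ob_zero[OF X] by (simp_all add: kernel_def)
  have "\<exists>g\<in>Arr T (susp_ob T m V) W. h = k \<cdot>\<^bsub>T\<^esub> g"
    if h: "h \<in> Arr T (susp_ob T m V) X" "fun_map F h 0 x = \<one>\<^bsub>deg (fun_ob F (susp_ob T m V)) 0\<^esub>" for m h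
  proof -
    let ?h = "susp T (- m) h"
    have h': "?h \<in> Arr T V (susp_ob T (- m) X)"
      using susp_closed[OF susp_ob_closed[OF V] X h(1), of "- m"] susp_ob_cancel[OF V] by simp
    have hh: "susp T m ?h = h"
      using susp_cancel(1)[OF susp_ob_closed[OF V] X h(1)] .
    have d: "degree_map F (- m) X ?h 0 x \<in> carrier (deg (fun_ob F V) (- m))"
      using degree_map_closed[OF V X h' x] by simp
    interpret s: group_hom "deg (fun_ob F V) (- m)" "deg (fun_ob F (susp_ob T m V)) 0" "fun_shift F m V 0"
      using shift_group_hom[OF V, of m 0] by simp
    have "fun_shift F m V 0 (degree_map F (- m) X ?h 0 x) = \<one>\<^bsub>deg (fun_ob F (susp_ob T m V)) 0\<^esub>"
      using degree_map_susp[OF X V x h'] hh h by simp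
    \<comment> \<open>Injectivity of the shift puts the desuspended map into the kernel in degree
      \<open>- m\<close> at \<open>V\<close>, where \<open>surj\<close> applies.\<close>
    moreover have "inj_on (fun_shift F m V 0) (carrier (deg (fun_ob F V) (- m)))"
      using shift_bij_betw[OF V, of m 0] unfolding bij_betw_def by simp
    ultimately have "degree_map F (- m) X ?h 0 x = \<one>\<^bsub>deg (fun_ob F V) (- m)\<^esub>"
      using d s.inj_on_one_iff by blast
    then have "?h \<in> carrier (deg (fun_ob ?K V) (- m))"
      using h' unfolding kernel_functor_simps kernel_def by simp
    \<comment> \<open>The kernel functor inherits maps and shifts from \<open>Ext_functor\<close>,
      so this equation reads \<open>k \<cdot> g = h\<close>.\<close>
    then have "\<exists>g\<in>Arr T (susp_ob T m V) W. fun_map ?K g 0 (\<xi> W 0 (Id T W)) = fun_shift ?K m V 0 ?h"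
      by (rule Ext_transformation_surj_susp[OF nat V W surj])
    then show ?thesis
      using hh unfolding k_def by auto
  qed
  then show ?thesis
    using W k by blast
qed

text \<open>Degree \<open>d\<close> at \<open>Y\<close> corresponds to degree zero at
  \<open>susp_ob T (- d) Y\<close>, where bijectivity is assumed.\<close>

lemma graded_representable_if_degree_zero:
  assumes X: "X \<in> Ob T" and x: "x \<in> carrier (deg (fun_ob F X) 0)"
    and bij: "\<And>V. V \<in> Ob T \<Longrightarrow>
      bij_betw (\<lambda>h. fun_map F h 0 x) (Arr T V X) (carrier (deg (fun_ob F V) 0))"
  shows "graded_representable A T \<phi> F"
proof -
  let ?\<zeta> = "\<lambda>Y d h. degree_map F d X h 0 x"
  note nat = yoneda_natural_transformation[OF X x]
  have "bij_betw (?\<zeta> Y d) (Arr T Y (susp_ob T d X)) (carrier (deg (fun_ob F Y) d))"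
    if Y: "Y \<in> Ob T" for Y d
  proof -
    let ?S = "susp_ob T (- d) Y" and ?B = "carrier (deg (fun_ob F (susp_ob T (- d) Y)) 0)"
    have S: "?S \<in> Ob T"
      using susp_ob_closed Y .
    have "bij_betw (susp T (- d)) (Arr T Y (susp_ob T d X)) (Arr T ?S X)"
      using susp_bij_betw[OF Y susp_ob_closed[OF X], of "- d" d] susp_ob_cancel[OF X] by simp
    then have "bij_betw ((\<lambda>h. fun_map F h 0 x) \<circ> susp T (- d)) (Arr T Y (susp_ob T d X)) ?B"
      using bij_betw_trans bij[OF S] by blast
    then have "bij_betw (fun_shift F (- d) Y 0 \<circ> ?\<zeta> Y d) (Arr T Y (susp_ob T d X)) ?B"
      using degree_map_susp[OF X Y x, of _ "- d"] by (subst (asm) bij_betw_cong) auto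
    moreover have "?\<zeta> Y d ` Arr T Y (susp_ob T d X) \<subseteq> carrier (deg (fun_ob F Y) d)"
      using degree_map_closed[OF Y X _ x] by auto
    moreover have "bij_betw (fun_shift F (- d) Y 0) (carrier (deg (fun_ob F Y) d)) ?B"
      using shift_bij_betw[OF Y, of "- d" 0] by simp
    \<comment> \<open>The composite and its outer factor are bijective, hence so is the inner
      factor.\<close>
    ultimately show ?thesis
      using bij_betw_comp_iff2 by blast
  qed
  then have "\<forall>Y\<in>Ob T. gmod_iso A (fun_ob (Ext_functor T \<phi> X) Y) (fun_ob F Y) (?\<zeta> Y)"
    using nat unfolding gmod_iso_def natural_transformation_def by simp
  then show ?thesis
    unfolding graded_representable_def using X nat by blast
qed

end

theorem corollary2p19:
  fixes R :: "('r, 'y) ring_scheme" and A :: "int \<Rightarrow> 'r set"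
    and T :: "('o, 'm, 'z) tricat_scheme" and \<phi> :: "int \<Rightarrow> 'r \<Rightarrow> 'o \<Rightarrow> 'm"
    and F :: "('o, 'm, 'r, 'n) gfun"
  assumes "graded_commutative_ring R A"
    and "triangulated_category T"
    and "graded_linear_category R A T \<phi>"
    and "strongly_generated T"
    and "idempotent_complete T"
    and "graded_linear_functor R A T \<phi> F"
    and "cohomological T F"
    and "locally_finitely_presented A T \<phi> F"
  shows "graded_representable A T \<phi> F"
proof -
  interpret graded_linear_functor R A T \<phi> F
    by fact
  interpret deg0: cohomological_functor T "\<lambda>X. deg (fun_ob F X) 0" "\<lambda>h. fun_map F h 0"
    using cohomological_functor_degree_zero assms(7) .
  have "locally_finitely_generated A T \<phi> F"
    using assms(8) unfolding locally_finitely_presented_def by blast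
  then have fg: "\<exists>X\<in>Ob T. \<exists>x\<in>carrier (deg (fun_ob F X) 0). \<forall>m. deg0.epi_at X x (susp_ob T m V)"
    if "V \<in> Ob T" for V
    unfolding deg0.epi_at_def using locally_finitely_generated_degree_zero that by blast
  obtain P z where "P \<in> Ob T" "z \<in> carrier (deg (fun_ob F P) 0)"
    "\<forall>V\<in>Ob T. bij_betw (\<lambda>h. fun_map F h 0 z) (Arr T V P) (carrier (deg (fun_ob F V) 0))"
    using deg0.representable[OF assms(5,4) fg locally_finitely_presented_degree_zero[OF assms(8)]]
    by blast
  then show ?thesis
    using graded_representable_if_degree_zero by blast
qed

end
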